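(* Let $C$ be a nonempty closed convex bounded subset of a real Hilbert space $H$ with $\operatorname{diam}(C)\le d$, where $d\in\mathbb{N}^*$. Let $T_1,\dots,T_N:C\to C$ be nonexpansive mappings with a common fixed point $p\in C$ such that $\bigcap_{i=1}^N\mathrm{Fix}(T_i)=\mathrm{Fix}(T_N\cdots T_1)$. Suppose $\rho:\mathbb{N}\times(0,\infty)\to(0,\infty)$ is nondecreasing in its second argument, satisfies $\rho(b,\varepsilon)\le\varepsilon$ for all $b\in\mathbb{N}$ and $\varepsilon>0$, and for all $b\in\mathbb{N}$, $x\in C$, $\varepsilon>0$ and every cyclic permutation $\pi$ of $\{1,\dots,N\}$, $$\|x-p\|\le b\ \text{ and }\ \|T_{\pi(N)}\cdots T_{\pi(1)}x-x\|<\rho(b,\varepsilon)\ \text{ imply }\ \|T_ix-x\|<\varepsilon\ \text{ for all }1\le i\le N .$$ Let $(\lambda_n)\subset(0,1]$, let $\mathcal{G}:C\to C$ be a strict contraction with Lipschitz constant $\tau\in(0,1)$, and let $\chi:\mathbb{N}\to\mathbb{N}$, $\phi_3:(0,\infty)\times\mathbb{N}\to\mathbb{N}$, $\phi_4:(0,\infty)\to\mathbb{N}$ satisfy: 1. $\lambda_n\le 1/k$ for all positive integers $k$ and all $n\ge\chi(k)$; 2. $\phi_3(\varepsilon,n)\ge n$ for all $\varepsilon>0$, $n\in\mathbb{N}$; 3. $\prod_{i=n}^m(1-\lambda_i(1-\tau))\le\varepsilon$ for all $\varepsilon>0$ and all $n,m\in\mathbb{N}$ with $m\ge\phi_3(\varepsilon,n)$;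 4. $\sum_{i=\phi_4(\varepsilon)}^\infty|\lambda_{i+N}-\lambda_i|\le\varepsilon$ for all $\varepsilon>0$. Let $u_0\in C$ and $u_{n+1}:=(1-\lambda_{n+1})T_{[n+1]}(u_n)+\lambda_{n+1}\mathcal{G}(T_{[n+1]}(u_n))$ for $n\in\mathbb{N}$. Then $$\forall\varepsilon>0\ \forall g:\mathbb{N}\to\mathbb{N}\ \exists n\le\Xi(\varepsilon,g;\chi,\phi_3,\phi_4,d,\tau)\quad \|u_n-u_{\tilde g(n)}\|\le\varepsilon ,$$ where $\tilde g(n):=\max\{n,g(n)\}$ and $$\Xi(\varepsilon,g;\chi,\phi_3,\phi_4,d,\tau):=\phi_3'\!\left(\frac{\varepsilon^2}{12d^2},\ \max\left\{n_0,\ \hat\chi\!\left(\rho\!\left(d,\frac1{k_{i_0}N}\right)\right)\right\}\right),$$ with $\phi_3'$, $n_0$, $\hat\chi$, $k_{i_0}$ as defined in the context.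
   Context: $\mathbb{N}$ denotes the nonnegative integers and $\mathbb{N}^*$ the positive integers; $[n]:=n\bmod N$ with representatives in $\{1,\dots,N\}$ (so $T_{[n]}=T_N$ when $N\mid n$). A cyclic permutation here is one of the form $\pi(n)=n+k\bmod N$ for some $k\in\mathbb{N}$. $F^{(m)}$ denotes the $m$-fold iterate of $F$. For a function $F$ defined on $\mathbb{N}$ or $\mathbb{N}^*$ with values in $\mathbb{N}$, $F^M(n):=\max\{F(i):i\le n\}$ ($i$ ranging over the domain). Definitions, for given $\varepsilon>0$ and $g$: $$\phi_3'(\eta,n):=\max\{n,\max\{\phi_3(\eta,i):i\le n\}\},\qquad \hat\chi(\eta):=\max\{\phi_3(\eta/(2d),\phi_4(\eta/(4d))),\ \chi(\lceil Nd/(2\eta)\rceil)\},$$ $$n_0:=\max\left\{\chi\!\left(\left\lceil\frac{96d}{(1-\tau)\varepsilon^2}\right\rceil\right),\chi\!\left(\left\lceil\frac{48d^2}{(1-\tau)\varepsilon^2}\right\rceil\right)\right\},$$ $$\Omega_d(\eta,g,n):=\frac{\eta^2}{18d\,\max\{1,\ \tilde g(\phi_3(\eta^2/(3d^2),n))-n\}},\qquad \Omega_d^M(\eta,g,n):=\min\{\Omega_d(\eta,g,i):i\le n\},$$ where in $\Omega_d(\eta,g,n)$, $\tilde g(m)=\max\{m,g(m)\}$ is formed from the function argument $g$. Define $f:\mathbb{N}^*\to\mathbb{N}^*$ by $$f(k):=\left\lceil \frac{1}{\rho\Big(d,\ \Omega_d^M\big(\varepsilon/2,\ \tilde g^M,\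 \max\{n_0,\hat\chi(\rho(d,1/(Nk)))\}\big)\Big)}\right\rceil .$$ Put $$\varepsilon_d:=\frac{((1-\tau)\varepsilon^2/96)^2}{2d^2},\quad \tilde\varepsilon:=\frac{(1-\tau)^2}{6+8d}\varepsilon_d,\quad N_0:=\lceil8d^4/\tilde\varepsilon^4\rceil,\quad i_0:=\lceil\log_\tau(\tilde\varepsilon/(6d^2))-1\rceil$$ (read $i_0$ as $0$ if this is negative), $\tilde f(n):=\max\{f^M(16dn^2),16dn^2\}$, and for $i\ge0$ $$f_i(k):=\tilde f^{(N_0^i)}(k),\quad \tilde f_i(n):=\max\{f_i^M(16dn^2),16dn^2\},\quad k_0:=\tilde f_0^{(N_0)}(1),\quad k_{i+1}:=\tilde f_i^{(N_0)}(k_i).$$ *)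

theory Defs
  imports "HOL-Analysis.Analysis"
begin

definition Fix :: "'a set \<Rightarrow> ('a \<Rightarrow> 'a) \<Rightarrow> 'a set"
  where "Fix C S = {x \<in> C. S x = x}"

text \<open>Residue of \<open>n\<close> modulo \<open>N\<close> with representatives \<open>1, \<dots>, N\<close> (for \<open>N \<ge> 1\<close>).\<close>
definition cyc :: "nat \<Rightarrow> nat \<Rightarrow> nat"
  where "cyc N n = (if N dvd n then N else n mod N)"

text \<open>Only the values of the permutation on \<open>{1..N}\<close> are constrained.\<close>
definition cyclic_perm :: "nat \<Rightarrow> (nat \<Rightarrow> nat) \<Rightarrow> bool"
  where "cyclic_perm N \<pi> \<longleftrightarrow> (\<exists>k. \<forall>i\<in>{1..N}. \<pi> i = cyc N (i + k))"

text \<open>The composition \<open>T (\<pi> N) \<circ> \<dots> \<circ> T (\<pi> 1)\<close>; \<open>T (\<pi> 1)\<close> is applied first.\<close>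
definition compose_all :: "nat \<Rightarrow> (nat \<Rightarrow> 'a \<Rightarrow> 'a) \<Rightarrow> (nat \<Rightarrow> nat) \<Rightarrow> 'a \<Rightarrow> 'a"
  where "compose_all N T \<pi> = fold (\<lambda>i. T (\<pi> i)) [1..<Suc N]"

definition gtilde :: "(nat \<Rightarrow> nat) \<Rightarrow> nat \<Rightarrow> nat"
  where "gtilde g n = max n (g n)"

text \<open>The running maximum \<open>F\<^sup>M\<close> of a function \<open>F\<close> with domain \<open>D\<close>: either \<open>UNIV\<close>, or
  \<open>{1..}\<close> for functions on the positive integers.  In the latter case the value at \<open>0\<close>
  is meaningless (maximum of the empty set) and is never used below.\<close>
definition runmax :: "nat set \<Rightarrow> (nat \<Rightarrow> nat) \<Rightarrow> nat \<Rightarrow> nat"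
  where "runmax D F n = Max (F ` {i \<in> D. i \<le> n})"

definition phi3' :: "(real \<Rightarrow> nat \<Rightarrow> nat) \<Rightarrow> real \<Rightarrow> nat \<Rightarrow> nat"
  where "phi3' \<phi>\<^sub>3 \<eta> n = max n (Max (\<phi>\<^sub>3 \<eta> ` {..n}))"

definition chi_hat ::
    "(nat \<Rightarrow> nat) \<Rightarrow> (real \<Rightarrow> nat \<Rightarrow> nat) \<Rightarrow> (real \<Rightarrow> nat) \<Rightarrow> nat \<Rightarrow> nat \<Rightarrow> real \<Rightarrow> nat"
  where "chi_hat chi \<phi>\<^sub>3 \<phi>\<^sub>4 N d \<eta> =
    max (\<phi>\<^sub>3 (\<eta> / (2 * real d)) (\<phi>\<^sub>4 (\<eta> / (4 * real d))))
        (chi (nat \<lceil>real N * real d / (2 * \<eta>)\<rceil>))"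

definition n_zero :: "(nat \<Rightarrow> nat) \<Rightarrow> nat \<Rightarrow> real \<Rightarrow> real \<Rightarrow> nat"
  where "n_zero chi d \<tau> \<epsilon> =
    max (chi (nat \<lceil>96 * real d / ((1 - \<tau>) * \<epsilon>\<^sup>2)\<rceil>))
        (chi (nat \<lceil>48 * (real d)\<^sup>2 / ((1 - \<tau>) * \<epsilon>\<^sup>2)\<rceil>))"

definition Omega :: "(real \<Rightarrow> nat \<Rightarrow> nat) \<Rightarrow> nat \<Rightarrow> real \<Rightarrow> (nat \<Rightarrow> nat) \<Rightarrow> nat \<Rightarrow> real"
  where "Omega \<phi>\<^sub>3 d \<eta> g n =
    \<eta>\<^sup>2 / (18 * real d *
      max 1 (real (gtilde g (\<phi>\<^sub>3 (\<eta>\<^sup>2 / (3 * (real d)\<^sup>2)) n)) - real n))"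

definition Omega_min :: "(real \<Rightarrow> nat \<Rightarrow> nat) \<Rightarrow> nat \<Rightarrow> real \<Rightarrow> (nat \<Rightarrow> nat) \<Rightarrow> nat \<Rightarrow> real"
  where "Omega_min \<phi>\<^sub>3 d \<eta> g n = Min (Omega \<phi>\<^sub>3 d \<eta> g ` {..n})"

text \<open>The function \<open>f\<close>, meaningful for arguments \<open>k \<ge> 1\<close>.\<close>
definition f_fun ::
    "(nat \<Rightarrow> nat) \<Rightarrow> (real \<Rightarrow> nat \<Rightarrow> nat) \<Rightarrow> (real \<Rightarrow> nat) \<Rightarrow> (nat \<Rightarrow> real \<Rightarrow> real) \<Rightarrow>
     nat \<Rightarrow> nat \<Rightarrow> real \<Rightarrow> real \<Rightarrow> (nat \<Rightarrow> nat) \<Rightarrow> nat \<Rightarrow> nat"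
  where "f_fun chi \<phi>\<^sub>3 \<phi>\<^sub>4 \<rho> N d \<tau> \<epsilon> g k =
    nat \<lceil>1 / \<rho> d (Omega_min \<phi>\<^sub>3 d (\<epsilon> / 2) (runmax UNIV (gtilde g))
      (max (n_zero chi d \<tau> \<epsilon>)
           (chi_hat chi \<phi>\<^sub>3 \<phi>\<^sub>4 N d (\<rho> d (1 / (real N * real k))))))\<rceil>"

definition eps_d :: "nat \<Rightarrow> real \<Rightarrow> real \<Rightarrow> real"
  where "eps_d d \<tau> \<epsilon> = ((1 - \<tau>) * \<epsilon>\<^sup>2 / 96)\<^sup>2 / (2 * (real d)\<^sup>2)"

definition eps_tilde :: "nat \<Rightarrow> real \<Rightarrow> real \<Rightarrow> real"
  where "eps_tilde d \<tau> \<epsilon> = (1 - \<tau>)\<^sup>2 / (6 + 8 * real d) * eps_d d \<tau> \<epsilon>"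

definition N_zero :: "nat \<Rightarrow> real \<Rightarrow> real \<Rightarrow> nat"
  where "N_zero d \<tau> \<epsilon> = nat \<lceil>8 * real d ^ 4 / eps_tilde d \<tau> \<epsilon> ^ 4\<rceil>"

text \<open>A negative ceiling is sent to \<open>0\<close> by \<open>nat\<close>, as intended.\<close>
definition i_zero :: "nat \<Rightarrow> real \<Rightarrow> real \<Rightarrow> nat"
  where "i_zero d \<tau> \<epsilon> = nat \<lceil>log \<tau> (eps_tilde d \<tau> \<epsilon> / (6 * (real d)\<^sup>2)) - 1\<rceil>"

text \<open>The map \<open>F \<mapsto> (n \<mapsto> max {F\<^sup>M(16 d n\<^sup>2), 16 d n\<^sup>2})\<close> on functions on the positive
  integers, which sends \<open>f\<close> and \<open>f\<^sub>i\<close> to their tilde versions.\<close>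
definition ftilde :: "nat \<Rightarrow> (nat \<Rightarrow> nat) \<Rightarrow> nat \<Rightarrow> nat"
  where "ftilde d F n = max (runmax {1..} F (16 * d * n\<^sup>2)) (16 * d * n\<^sup>2)"

definition f_iter :: "nat \<Rightarrow> nat \<Rightarrow> (nat \<Rightarrow> nat) \<Rightarrow> nat \<Rightarrow> nat \<Rightarrow> nat"
  where "f_iter d N\<^sub>0 f i = ftilde d f ^^ (N\<^sub>0 ^ i)"

primrec k_seq :: "nat \<Rightarrow> nat \<Rightarrow> (nat \<Rightarrow> nat) \<Rightarrow> nat \<Rightarrow> nat"
  where
    "k_seq d N\<^sub>0 f 0 = (ftilde d (f_iter d N\<^sub>0 f 0) ^^ N\<^sub>0) 1"
  | "k_seq d N\<^sub>0 f (Suc i) = (ftilde d (f_iter d N\<^sub>0 f i) ^^ N\<^sub>0) (k_seq d N\<^sub>0 f i)"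

text \<open>The rate \<open>\<Xi>\<close>; its dependence on \<open>\<rho>\<close> and \<open>N\<close> is made explicit.\<close>
definition Xi ::
    "(nat \<Rightarrow> nat) \<Rightarrow> (real \<Rightarrow> nat \<Rightarrow> nat) \<Rightarrow> (real \<Rightarrow> nat) \<Rightarrow> (nat \<Rightarrow> real \<Rightarrow> real) \<Rightarrow>
     nat \<Rightarrow> nat \<Rightarrow> real \<Rightarrow> real \<Rightarrow> (nat \<Rightarrow> nat) \<Rightarrow> nat"
  where "Xi chi \<phi>\<^sub>3 \<phi>\<^sub>4 \<rho> N d \<tau> \<epsilon> g =
    (let k = k_seq d (N_zero d \<tau> \<epsilon>) (f_fun chi \<phi>\<^sub>3 \<phi>\<^sub>4 \<rho> N d \<tau> \<epsilon> g) (i_zero d \<tau> \<epsilon>)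
     in phi3' \<phi>\<^sub>3 (\<epsilon>\<^sup>2 / (12 * (real d)\<^sup>2))
          (max (n_zero chi d \<tau> \<epsilon>)
               (chi_hat chi \<phi>\<^sub>3 \<phi>\<^sub>4 N d (\<rho> d (1 / (real k * real N))))))"

end

theory Submission
  imports Defs
begin

text \<open>
  Let \<open>S\<close> be the composition \<open>T\<^sub>N \<cdots> T\<^sub>1\<close>.  Qualitatively, the iteration converges to the fixed point \<open>q\<close> of
  \<open>P \<circ> G\<close>, where \<open>P\<close> is the metric projection onto the set of fixed points of \<open>S\<close>; equivalently, \<open>q\<close> is fixed
  by \<open>S\<close> and \<open>\<langle>G q - q, y - q\<rangle> \<le> 0\<close> for all fixed points \<open>y\<close>.  The iterates are asymptotically fixed by all
  \<open>T\<^sub>i\<close>, so they may be inserted for \<open>y\<close>, and then the squared distance to \<open>q\<close> obeys a recursion with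
  contraction factors \<open>1 - \<lambda>\<^sub>n(1 - \<tau>)\<close>, whose product tends to zero.  The proof makes each of these steps
  finitary.

  The point \<open>q\<close> is replaced by some \<open>x\<close> that is fixed up to \<open>1 / f k\<close> and satisfies the variational
  inequality, up to a small error, against all points fixed up to \<open>1 / k\<close>
  (\<open>quantitative_fixed_point_of_projection_after_contraction\<close>).  A single projection is found by a
  search through \<open>M\<close> levels of precision: a squared distance can drop by \<open>D\<^sup>2 / M\<close> at most \<open>M\<close> times
  (\<open>approximate_projection\<close>).  The fixed point of the contraction \<open>P \<circ> G\<close> is then approximated by finitely
  many such projections, nested so that an earlier one is precise enough for all outcomes of the
  later ones (\<open>iterate_projections\<close>).  All levels of precision lie on the sequence of iterates of
  \<open>ftilde d f\<close> at \<open>1\<close>, so the cost is a position in that sequence, and \<open>tower_le_k_seq\<close> shows that \<open>k_seq\<close>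
  lies beyond it.

  On the side of the iteration, \<open>asymptotic_regularity\<close> and the modulus \<open>\<rho>\<close> make \<open>u\<^sub>n\<close> fixed up to \<open>1 / k\<close> by \<open>S\<close>
  from an explicit index on.  The function \<open>f\<close> is chosen such that \<open>x\<close> is fixed by each \<open>T\<^sub>i\<close> so precisely
  that the errors of the recursion (\<open>distance_to_approximate_solution\<close>) remain small on the whole
  interval from this index to the largest one that \<open>g\<close> can select.  So \<open>u\<^sub>n\<close> and the iterate selected by
  \<open>g\<close> both lie within \<open>\<epsilon> / 2\<close> of \<open>x\<close>.
\<close>

section \<open>Iterates of the tilde operation\<close>

lemma runmax_ge:
  assumes "i \<in> D" "i \<le> n"
  shows "F i \<le> runmax D F n"
proof -
  have "finite {i \<in> D. i \<le> n}"
    by (rule finite_subset[of _ "{..n}"]) auto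
  thus ?thesis
    unfolding runmax_def using assms by (intro Max_ge) auto
qed

lemma runmax_mono:
  assumes "i \<in> D" "i \<le> m" "m \<le> n"
  shows "runmax D F m \<le> runmax D F n"
proof -
  have "finite {i \<in> D. i \<le> n}"
    by (rule finite_subset[of _ "{..n}"]) auto
  thus ?thesis
    unfolding runmax_def using assms by (intro Max_mono) auto
qed

lemma ftilde_ge_fun:
  assumes "1 \<le> k" "k \<le> 16 * d * n\<^sup>2"
  shows "F k \<le> ftilde d F n"
  using runmax_ge[of k "{1..}" "16 * d * n\<^sup>2" F] assms by (simp add: ftilde_def)

lemma ftilde_ge_square: "16 * d * n\<^sup>2 \<le> ftilde d F n"
  by (simp add: ftilde_def)

lemma le_square_arg:
  fixes d n :: nat
  assumes "1 \<le> d"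
  shows "n \<le> 16 * d * n\<^sup>2"
proof -
  have "n * 1 \<le> n * (16 * d * n)"
    using assms by (cases "n = 0") (auto intro!: mult_le_mono2)
  thus ?thesis by (simp add: power2_eq_square algebra_simps)
qed

lemma ftilde_ge_self: "1 \<le> d \<Longrightarrow> n \<le> ftilde d F n"
  using le_square_arg ftilde_ge_square le_trans by blast

text \<open>
  The running maximum over the positive integers is meaningless at \<open>0\<close>, so monotonicity holds from \<open>1\<close> on
  only, and the comparison of iterates below keeps track of this.
\<close>

lemma ftilde_mono:
  assumes "1 \<le> d" "1 \<le> m" "m \<le> n"
  shows "ftilde d F m \<le> ftilde d F n"
proof -
  have "16 * d * m\<^sup>2 \<le> 16 * d * n\<^sup>2"
    using assms by (intro mult_le_mono2 power_mono) auto
  moreover have "1 \<le> 16 * d * m\<^sup>2"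
    using le_square_arg[of d m] assms by linarith
  ultimately show ?thesis
    unfolding ftilde_def by (intro max.mono runmax_mono[of 1]) auto
qed

lemma funpow_le_funpow:
  fixes P Q :: "nat \<Rightarrow> nat"
  assumes self: "\<And>n. 1 \<le> n \<Longrightarrow> n \<le> Q n"
    and mono: "\<And>m n. 1 \<le> m \<Longrightarrow> m \<le> n \<Longrightarrow> Q m \<le> Q n"
    and le: "\<And>n. 1 \<le> n \<Longrightarrow> Q n \<le> P n"
    and start: "1 \<le> m" "m \<le> n"
  shows "1 \<le> (Q ^^ j) m \<and> (Q ^^ j) m \<le> (P ^^ j) n"
proof (induction j)
  case 0
  show ?case using start by simp
next
  case (Suc j)
  have "1 \<le> Q ((Q ^^ j) m)" using Suc self[of "(Q ^^ j) m"] by linarith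
  moreover have "Q ((Q ^^ j) m) \<le> P ((P ^^ j) n)"
    using Suc mono[of "(Q ^^ j) m" "(P ^^ j) n"] le[of "(P ^^ j) n"] by linarith
  ultimately show ?case by simp
qed

text \<open>
  Every nested bound in the definition of \<open>k_seq\<close> is dominated by a plain iterate of \<open>ftilde d f\<close>,
  so the whole argument is indexed by the position in this single sequence.
\<close>

definition tower :: "nat \<Rightarrow> (nat \<Rightarrow> nat) \<Rightarrow> nat \<Rightarrow> nat"
  where "tower d f m = (ftilde d f ^^ m) 1"

lemma tower_0 [simp]: "tower d f 0 = 1"
  and tower_Suc: "tower d f (Suc m) = ftilde d f (tower d f m)"
  by (simp_all add: tower_def)

lemma tower_mono:
  assumes "1 \<le> d" "m \<le> n"
  shows "tower d f m \<le> tower d f n"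
  using assms(2)
proof (induction rule: dec_induct)
  case (step n)
  thus ?case using ftilde_ge_self[OF assms(1), of "tower d f n" f] by (simp add: tower_Suc)
qed simp

lemma tower_ge_1: "1 \<le> d \<Longrightarrow> 1 \<le> tower d f m"
  using tower_mono[of d 0 m f] by simp

lemma ftilde_funpow_ge: "1 \<le> d \<Longrightarrow> n \<le> (ftilde d f ^^ j) n"
  using ftilde_ge_self le_trans by (induction j) fastforce+

text \<open>
  Only a lower bound on \<open>k_seq\<close> matters, and its last factor already supplies one: \<open>ftilde d F\<close>
  dominates \<open>F\<close>, so the \<open>N\<^sub>0\<close>-fold iterate of the tilde version of an \<open>N\<^sub>0 ^ i\<close>-fold iterate is at least
  an \<open>N\<^sub>0 ^ Suc i\<close>-fold iterate.  The maximum accounts for the index \<open>0\<close>, which also uses \<open>f_iter\<close> at \<open>0\<close>.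
\<close>

lemma tower_le_k_seq:
  assumes d: "1 \<le> d"
  shows "tower d f (N\<^sub>0 ^ max 1 i) \<le> k_seq d N\<^sub>0 f i"
proof -
  have step: "tower d f (N\<^sub>0 ^ Suc i) \<le> (ftilde d (f_iter d N\<^sub>0 f i) ^^ N\<^sub>0) n"
    if n: "1 \<le> n" for i n
  proof -
    let ?Q = "ftilde d f ^^ (N\<^sub>0 ^ i)"
    have mono: "?Q a \<le> ?Q b" if "1 \<le> a" "a \<le> b" for a b
      using funpow_le_funpow[of "ftilde d f" "ftilde d f" a b "N\<^sub>0 ^ i"]
        ftilde_ge_self[OF d] ftilde_mono[OF d] that by blast
    have "?Q a \<le> ftilde d (f_iter d N\<^sub>0 f i) a" if "1 \<le> a" for a
      using ftilde_ge_fun[of a d a "f_iter d N\<^sub>0 f i"] le_square_arg[OF d] that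
      by (simp add: f_iter_def)
    with mono have "(?Q ^^ N\<^sub>0) 1 \<le> (ftilde d (f_iter d N\<^sub>0 f i) ^^ N\<^sub>0) n"
      using funpow_le_funpow[of ?Q "ftilde d (f_iter d N\<^sub>0 f i)" 1 n N\<^sub>0] n
        ftilde_funpow_ge[OF d] by blast
    moreover have "(?Q ^^ N\<^sub>0) 1 = tower d f (N\<^sub>0 ^ Suc i)"
      by (simp add: tower_def funpow_mult mult.commute)
    ultimately show ?thesis by simp
  qed
  show ?thesis
  proof (induction i)
    case 0
    show ?case using step[of 1 0] by simp
  next
    case (Suc i)
    have "1 \<le> k_seq d N\<^sub>0 f i"
      using Suc tower_ge_1[OF d, of f "N\<^sub>0 ^ max 1 i"] by linarith
    thus ?case using step[of "k_seq d N\<^sub>0 f i" i] by (simp add: max_def)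
  qed
qed

section \<open>Approximate projections along a filtration\<close>

lemma norm_diff_scaleR_squared:
  fixes a b :: "'a::real_inner"
  shows "(norm (b - t *\<^sub>R a))\<^sup>2 = (norm b)\<^sup>2 - 2 * t * (b \<bullet> a) + t\<^sup>2 * (norm a)\<^sup>2"
  unfolding power2_norm_eq_inner
  by (simp add: inner_diff_left inner_diff_right inner_commute power2_eq_square algebra_simps)

text \<open>
  What the approximate fixed point sets of a nonexpansive map provide for computing projections
  onto the fixed point set: a decreasing sequence of sets \<open>E m\<close> around a common point \<open>p\<close>.  They
  are convex only up to a loss of precision, and the intermediate sets \<open>E' m\<close> measure that loss:
  segments with ends in \<open>E' m\<close> stay in \<open>E m\<close>.
\<close>

locale segment_filtration =
  fixes E E' :: "nat \<Rightarrow> 'a::real_inner set" and D :: real and p :: 'a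
  assumes E_Suc_subset: "E (Suc m) \<subseteq> E' m"
    and E'_subset: "E' m \<subseteq> E m"
    and p_in: "p \<in> E m"
    and bound: "x \<in> E 0 \<Longrightarrow> y \<in> E 0 \<Longrightarrow> norm (x - y) \<le> D"
    and segment: "x \<in> E' m \<Longrightarrow> y \<in> E' m \<Longrightarrow> 0 \<le> t \<Longrightarrow> t \<le> 1 \<Longrightarrow> x + t *\<^sub>R (y - x) \<in> E m"
begin

lemma E_antimono: "m \<le> n \<Longrightarrow> E n \<subseteq> E m"
  using lift_Suc_antimono_le[of E] E_Suc_subset E'_subset by blast

lemma E_less_subset: "m < n \<Longrightarrow> E n \<subseteq> E' m"
  using E_antimono[of "Suc m" n] E_Suc_subset[of m] by auto

text \<open>
  Stands in for the point nearest to \<open>v\<close> in the intersection of all \<open>E m\<close>.  If no such \<open>x\<close> existed, one could start at \<open>p\<close> in the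
  innermost set and move outwards, decreasing the squared distance to \<open>v\<close> by more than \<open>D\<^sup>2 / M\<close> at
  each of \<open>M\<close> moves; but it starts at no more than \<open>D\<^sup>2\<close> and cannot become negative.  The freedom in
  \<open>h\<close> lets the minimizer be much more precise than the competitors that it beats.
\<close>

lemma approximate_minimizer:
  assumes v: "norm (v - p) \<le> D" and M: "1 \<le> M"
  shows "\<exists>l<M. \<exists>x\<in>E (a + Suc l * h). \<forall>y\<in>E (a + l * h).
    (norm (v - x))\<^sup>2 \<le> (norm (v - y))\<^sup>2 + D\<^sup>2 / M"
proof (rule ccontr)
  assume neg: "\<not> ?thesis"
  have "\<exists>y\<in>E (a + (M - j) * h). (norm (v - y))\<^sup>2 \<le> D\<^sup>2 - j * (D\<^sup>2 / M) \<and>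
      (1 \<le> j \<longrightarrow> (norm (v - y))\<^sup>2 < D\<^sup>2 - j * (D\<^sup>2 / M))" if "j \<le> M" for j
    using that
  proof (induction j)
    case 0
    have "(norm (v - p))\<^sup>2 \<le> D\<^sup>2" using v by (intro power_mono) auto
    thus ?case using p_in by auto
  next
    case (Suc j)
    then obtain x where x: "x \<in> E (a + (M - j) * h)" "(norm (v - x))\<^sup>2 \<le> D\<^sup>2 - j * (D\<^sup>2 / M)"
      by auto
    have "M - j = Suc (M - Suc j)" "M - Suc j < M" using Suc.prems by auto
    then obtain y where y: "y \<in> E (a + (M - Suc j) * h)"
      "(norm (v - y))\<^sup>2 + D\<^sup>2 / M < (norm (v - x))\<^sup>2"
      using neg x(1) by (metis not_less)
    have "(norm (v - y))\<^sup>2 < D\<^sup>2 - Suc j * (D\<^sup>2 / M)"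
      using x(2) y(2) by (simp add: algebra_simps add_divide_distrib)
    thus ?case using y(1) less_imp_le by blast
  qed
  from this[of M] obtain y where "(norm (v - y))\<^sup>2 < D\<^sup>2 - M * (D\<^sup>2 / M)"
    using M by blast
  thus False using M by (simp add: not_less[symmetric])
qed

text \<open>
  The usual passage from a minimizer to the variational inequality: compare \<open>x\<close> with a point at
  parameter \<open>t\<close> on the segment towards \<open>y\<close>.  An error \<open>D\<^sup>2 / M\<close> in the minimization is balanced by
  the quadratic term when \<open>t = 1 / sqrt M\<close>.
\<close>

lemma approximate_projection:
  assumes v: "norm (v - p) \<le> D" and M: "1 \<le> M" and h: "1 \<le> h"
  shows "\<exists>l<M. \<exists>x\<in>E (a + Suc l * h). \<forall>y\<in>E' (a + l * h). (v - x) \<bullet> (y - x) \<le> D\<^sup>2 / sqrt M"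
proof -
  obtain l x where l: "l < M" and x: "x \<in> E (a + Suc l * h)"
    and min: "\<And>y. y \<in> E (a + l * h) \<Longrightarrow> (norm (v - x))\<^sup>2 \<le> (norm (v - y))\<^sup>2 + D\<^sup>2 / M"
    using approximate_minimizer[OF v M] by blast
  have "(v - x) \<bullet> (y - x) \<le> D\<^sup>2 / sqrt M" if y: "y \<in> E' (a + l * h)" for y
  proof -
    define t where "t = 1 / sqrt M"
    have t: "0 < t" "t \<le> 1" "t\<^sup>2 = 1 / M" using M by (auto simp: t_def power_divide)
    have x': "x \<in> E' (a + l * h)" using x E_less_subset[of "a + l * h" "a + Suc l * h"] h by auto
    have "x + t *\<^sub>R (y - x) \<in> E (a + l * h)" using segment[OF x' y] t by simp
    from min[OF this] have "(norm (v - x))\<^sup>2 \<le> (norm ((v - x) - t *\<^sub>R (y - x)))\<^sup>2 + D\<^sup>2 * t\<^sup>2"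
      by (simp add: algebra_simps t)
    also have "(norm ((v - x) - t *\<^sub>R (y - x)))\<^sup>2
        = (norm (v - x))\<^sup>2 - 2 * t * ((v - x) \<bullet> (y - x)) + t\<^sup>2 * (norm (y - x))\<^sup>2"
      by (rule norm_diff_scaleR_squared)
    finally have "2 * t * ((v - x) \<bullet> (y - x)) \<le> t\<^sup>2 * (norm (y - x))\<^sup>2 + D\<^sup>2 * t\<^sup>2" by simp
    also have "(norm (y - x))\<^sup>2 \<le> D\<^sup>2"
      using bound[of y x] x' y E'_subset E_antimono[of 0] by (intro power_mono) auto
    hence "t\<^sup>2 * (norm (y - x))\<^sup>2 \<le> t\<^sup>2 * D\<^sup>2" by (intro mult_left_mono) auto
    hence "t\<^sup>2 * (norm (y - x))\<^sup>2 + D\<^sup>2 * t\<^sup>2 \<le> 2 * t * (t * D\<^sup>2)"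
      by (simp add: power2_eq_square algebra_simps)
    finally have "(v - x) \<bullet> (y - x) \<le> t * D\<^sup>2" using t by simp
    thus ?thesis by (simp add: t_def)
  qed
  thus ?thesis using l x by blast
qed

text \<open>
  Picard iteration for the contraction \<open>x \<mapsto> P (G x)\<close>, with \<open>P\<close> the projection onto the fixed point
  set, in approximate form.  To compare consecutive iterates \<open>x\<close> and \<open>z\<close>, each has to be an admissible
  competitor in the variational inequality of the other.  Hence \<open>x\<close>, which is chosen earlier, must be
  precise enough for every position that the later choice of \<open>z\<close> may return.  With \<open>i\<close> projections
  still to come, a lead of \<open>(M + 1) ^ i\<close> positions is enough: the next search starts one position
  later, moves by at most \<open>M - 1\<close> strides of length \<open>(M + 1) ^ (i - 1)\<close> and must keep one such stride
  as the lead of \<open>z\<close>.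

  Adding the two variational inequalities shows that the distance of consecutive iterates shrinks
  by the factor \<open>\<tau>\<close> up to an error \<open>sqrt (2 * \<delta>)\<close>; these errors add up to a geometric series.
\<close>

lemma iterate_projections:
  fixes G :: "'a \<Rightarrow> 'a" and M :: nat
  defines "\<delta> \<equiv> D\<^sup>2 / sqrt M"
  assumes G_in: "\<And>x. x \<in> E 0 \<Longrightarrow> norm (G x - p) \<le> D"
    and G: "\<And>x y. x \<in> E 0 \<Longrightarrow> y \<in> E 0 \<Longrightarrow> norm (G x - G y) \<le> \<tau> * norm (x - y)"
    and \<tau>: "0 < \<tau>" "\<tau> < 1" and M: "1 \<le> M"
    and x: "x' \<in> E 0" "x \<in> E (m + (M + 1) ^ i)"
      "\<And>y. y \<in> E' m \<Longrightarrow> (G x' - x) \<bullet> (y - x) \<le> \<delta>"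
      "norm (x - x') \<le> c + sqrt (2 * \<delta>) / (1 - \<tau>)" "0 \<le> c"
  shows "\<exists>n < m + (M + 1) ^ i. \<exists>z' \<in> E 0. \<exists>z \<in> E (Suc n).
    (\<forall>y\<in>E' n. (G z' - z) \<bullet> (y - z) \<le> \<delta>) \<and> norm (z - z') \<le> \<tau> ^ i * c + sqrt (2 * \<delta>) / (1 - \<tau>)"
  using x
proof (induction i arbitrary: m x x' c)
  case 0
  thus ?case by (intro exI[of _ m] conjI bexI[of _ x'] bexI[of _ x]) auto
next
  case (Suc i)
  define h where "h = (M + 1) ^ i"
  define e where "e = sqrt (2 * \<delta>)"
  have h: "1 \<le> h" by (simp add: h_def)
  have \<delta>: "0 \<le> \<delta>" by (simp add: \<delta>_def)
  have e: "0 \<le> e" "e\<^sup>2 = 2 * \<delta>" using \<delta> by (auto simp: e_def)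
  have x0: "x \<in> E 0" using Suc.prems(2) E_antimono by blast
  obtain l z where l: "l < M" and z: "z \<in> E (Suc m + Suc l * h)"
    and vi: "\<And>y. y \<in> E' (Suc m + l * h) \<Longrightarrow> (G x - z) \<bullet> (y - z) \<le> \<delta>"
    using approximate_projection[OF G_in[OF x0] M h, of "Suc m"] unfolding \<delta>_def by blast
  have z0: "z \<in> E 0" using z E_antimono by blast
  define m' where "m' = Suc m + l * h"
  have "(l + 1) * h \<le> M * h" using l by (intro mult_le_mono1) auto
  moreover have "(M + 1) ^ Suc i = M * h + h" by (simp add: h_def)
  ultimately have m': "m' + h \<le> m + (M + 1) ^ Suc i" "m < m' + h" "m' < m + (M + 1) ^ Suc i"
    using h by (auto simp: m'_def algebra_simps)
  have z_m: "z \<in> E' m" using z E_less_subset[OF m'(2)] by (auto simp: m'_def algebra_simps)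
  have x_m': "x \<in> E' m'" using Suc.prems(2) E_less_subset[OF m'(3)] by blast
  have "(norm (z - x))\<^sup>2 \<le> (G x' - x) \<bullet> (z - x) + (G x - z) \<bullet> (x - z) + (G x - G x') \<bullet> (z - x)"
    unfolding power2_norm_eq_inner by (simp add: inner_diff_left inner_diff_right inner_commute)
  also have "\<dots> \<le> \<delta> + \<delta> + norm (G x - G x') * norm (z - x)"
    using Suc.prems(3)[OF z_m] vi[of x] x_m' norm_cauchy_schwarz[of "G x - G x'" "z - x"]
    by (auto simp: m'_def)
  also have "\<dots> \<le> e\<^sup>2 + \<tau> * norm (x - x') * norm (z - x)"
    using mult_right_mono[OF G[OF x0 Suc.prems(1)], of "norm (z - x)"] e by simp
  finally have quad: "(norm (z - x))\<^sup>2 \<le> e\<^sup>2 + \<tau> * norm (x - x') * norm (z - x)" .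
  have step: "norm (z - x) \<le> \<tau> * norm (x - x') + e"
  proof (rule ccontr)
    assume "\<not> ?thesis"
    hence less: "\<tau> * norm (x - x') + e < norm (z - x)" by simp
    have nn: "0 \<le> \<tau> * norm (x - x')" using \<tau> by simp
    have "e \<le> norm (z - x)" using less nn by linarith
    hence "e\<^sup>2 \<le> e * norm (z - x)"
      unfolding power2_eq_square by (rule mult_left_mono) (rule e)
    moreover have "0 < norm (z - x)" using less nn e by linarith
    hence "(\<tau> * norm (x - x') + e) * norm (z - x) < norm (z - x) * norm (z - x)"
      using less by simp
    ultimately show False using quad by (simp add: power2_eq_square algebra_simps)
  qed
  have "\<tau> * norm (x - x') \<le> \<tau> * (c + e / (1 - \<tau>))"
    using Suc.prems(4) \<tau> unfolding e_def by (intro mult_left_mono) auto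
  hence "norm (z - x) \<le> \<tau> * (c + e / (1 - \<tau>)) + e" using step by linarith
  also have "\<dots> = \<tau> * c + e / (1 - \<tau>)" using \<tau> by (simp add: field_simps)
  finally have close: "norm (z - x) \<le> \<tau> * c + sqrt (2 * \<delta>) / (1 - \<tau>)" by (simp add: e_def)
  have "\<exists>n < m' + (M + 1) ^ i. \<exists>w' \<in> E 0. \<exists>w \<in> E (Suc n).
    (\<forall>y\<in>E' n. (G w' - w) \<bullet> (y - w) \<le> \<delta>)
    \<and> norm (w - w') \<le> \<tau> ^ i * (\<tau> * c) + sqrt (2 * \<delta>) / (1 - \<tau>)"
    using z vi close Suc.prems(5) \<tau>
    by (intro Suc.IH[of x z m' "\<tau> * c"] x0) (auto simp: m'_def h_def algebra_simps)
  then obtain n w' w where n: "n < m' + (M + 1) ^ i" and w: "w' \<in> E 0" "w \<in> E (Suc n)"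
    "\<forall>y\<in>E' n. (G w' - w) \<bullet> (y - w) \<le> \<delta>"
    "norm (w - w') \<le> \<tau> ^ i * (\<tau> * c) + sqrt (2 * \<delta>) / (1 - \<tau>)"
    by blast
  have "n < m + (M + 1) ^ Suc i" using n m'(1) by (simp add: h_def)
  moreover have "\<tau> ^ i * (\<tau> * c) = \<tau> ^ Suc i * c" by simp
  ultimately show ?case using w by metis
qed

text \<open>
  Once \<open>z\<close> nearly projects \<open>G z'\<close> and is close to \<open>z'\<close>, it nearly projects \<open>G z\<close>.
\<close>

lemma approximate_variational_inequality:
  fixes G :: "'a \<Rightarrow> 'a" and M :: nat
  defines "\<delta> \<equiv> D\<^sup>2 / sqrt M"
  assumes G_in: "\<And>x. x \<in> E 0 \<Longrightarrow> norm (G x - p) \<le> D"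
    and G: "\<And>x y. x \<in> E 0 \<Longrightarrow> y \<in> E 0 \<Longrightarrow> norm (G x - G y) \<le> \<tau> * norm (x - y)"
    and \<tau>: "0 < \<tau>" "\<tau> < 1" and M: "1 \<le> M"
  shows "\<exists>n < (M + 1) ^ Suc i. \<exists>z \<in> E (Suc n). \<forall>y\<in>E' n.
    (G z - z) \<bullet> (y - z) \<le> \<delta> + \<tau> ^ Suc i * D\<^sup>2 + \<tau> * D * sqrt (2 * \<delta>) / (1 - \<tau>)"
proof -
  have \<delta>: "0 \<le> \<delta>" by (simp add: \<delta>_def)
  have D: "0 \<le> D" using bound[OF p_in p_in] by simp
  define h where "h = (M + 1) ^ i"
  have h: "1 \<le> h" by (simp add: h_def)
  obtain l x where l: "l < M" and x: "x \<in> E (0 + Suc l * h)"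
    and vi: "\<And>y. y \<in> E' (0 + l * h) \<Longrightarrow> (G p - x) \<bullet> (y - x) \<le> \<delta>"
    using approximate_projection[OF G_in[OF p_in] M h, of 0] unfolding \<delta>_def by blast
  have x0: "x \<in> E 0" using x E_antimono by blast
  have "0 \<le> sqrt (2 * \<delta>) / (1 - \<tau>)" using \<delta> \<tau> by simp
  hence "norm (x - p) \<le> D + sqrt (2 * \<delta>) / (1 - \<tau>)" using bound[OF x0 p_in] by linarith
  hence "\<exists>n < l * h + (M + 1) ^ i. \<exists>z' \<in> E 0. \<exists>z \<in> E (Suc n).
    (\<forall>y\<in>E' n. (G z' - z) \<bullet> (y - z) \<le> \<delta>) \<and> norm (z - z') \<le> \<tau> ^ i * D + sqrt (2 * \<delta>) / (1 - \<tau>)"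
    using iterate_projections[OF G_in G \<tau> M p_in[of 0], of x "l * h" i D] x vi D
    by (auto simp: \<delta>_def h_def algebra_simps)
  then obtain n z' z where n: "n < l * h + (M + 1) ^ i" and z: "z' \<in> E 0" "z \<in> E (Suc n)"
    "\<And>y. y \<in> E' n \<Longrightarrow> (G z' - z) \<bullet> (y - z) \<le> \<delta>"
    "norm (z - z') \<le> \<tau> ^ i * D + sqrt (2 * \<delta>) / (1 - \<tau>)"
    by blast
  have z0: "z \<in> E 0" using z(2) E_antimono by blast
  have "(l + 1) * h \<le> (M + 1) * h" using l by (intro mult_le_mono1) auto
  moreover have "(M + 1) ^ Suc i = (M + 1) * h" by (simp add: h_def)
  moreover have "n < (l + 1) * h" using n by (simp add: h_def)
  ultimately have n': "n < (M + 1) ^ Suc i" by linarith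
  have "(G z - z) \<bullet> (y - z) \<le> \<delta> + \<tau> ^ Suc i * D\<^sup>2 + \<tau> * D * sqrt (2 * \<delta>) / (1 - \<tau>)"
    if y: "y \<in> E' n" for y
  proof -
    have y0: "y \<in> E 0" using y E'_subset E_antimono by blast
    have "(G z - z) \<bullet> (y - z) = (G z' - z) \<bullet> (y - z) + (G z - G z') \<bullet> (y - z)"
      by (simp add: inner_diff_left)
    also have "\<dots> \<le> \<delta> + norm (G z - G z') * norm (y - z)"
      using z(3)[OF y] norm_cauchy_schwarz[of "G z - G z'" "y - z"] by linarith
    also have "norm (G z - G z') * norm (y - z) \<le> \<tau> * (\<tau> ^ i * D + sqrt (2 * \<delta>) / (1 - \<tau>)) * D"
    proof (rule mult_mono)
      show le: "norm (G z - G z') \<le> \<tau> * (\<tau> ^ i * D + sqrt (2 * \<delta>) / (1 - \<tau>))"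
        using G[OF z0 z(1)] mult_left_mono[OF z(4), of \<tau>] \<tau> by linarith
      show "0 \<le> \<tau> * (\<tau> ^ i * D + sqrt (2 * \<delta>) / (1 - \<tau>))"
        using le norm_ge_zero order_trans by blast
    qed (use bound[OF y0 z0] in auto)
    finally show ?thesis by (simp add: algebra_simps power2_eq_square)
  qed
  thus ?thesis using n' z(2) by blast
qed

end

section \<open>Approximate fixed points of a nonexpansive map\<close>

text \<open>
  The inequality is strict because the modulus of regularity has strict premises.
\<close>

definition almost_fixed :: "'a::real_normed_vector set \<Rightarrow> ('a \<Rightarrow> 'a) \<Rightarrow> nat \<Rightarrow> 'a set"
  where "almost_fixed C S n = {x \<in> C. norm (S x - x) < 1 / real n}"

lemma almost_fixed_antimono:
  assumes "1 \<le> m" "m \<le> n"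
  shows "almost_fixed C S n \<subseteq> almost_fixed C S m"
proof -
  have "1 / real n \<le> 1 / real m" using assms by (intro divide_left_mono) auto
  thus ?thesis by (auto simp: almost_fixed_def)
qed

text \<open>
  If \<open>S\<close> moves both ends of a segment by at most \<open>\<theta>\<close>, then \<open>S z\<close> is at most \<open>\<theta>\<close> farther from either
  end than \<open>z\<close> is.  Since \<open>z\<close> is the only point with these two distances, uniform convexity of the
  norm forces \<open>S z\<close> close to \<open>z\<close>, within the order of the square root of \<open>\<theta>\<close>; this is where the
  square in \<open>16 * d * n\<^sup>2\<close> comes from.
\<close>

lemma segment_almost_fixed:
  fixes C :: "'a::real_inner set"
  assumes C: "convex C" "\<And>x y. x \<in> C \<Longrightarrow> y \<in> C \<Longrightarrow> norm (x - y) \<le> real d" and d: "1 \<le> d"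
    and S: "\<And>x y. x \<in> C \<Longrightarrow> y \<in> C \<Longrightarrow> norm (S x - S y) \<le> norm (x - y)"
    and n: "1 \<le> n"
    and x: "x \<in> almost_fixed C S (16 * d * n\<^sup>2)" and y: "y \<in> almost_fixed C S (16 * d * n\<^sup>2)"
    and t: "0 \<le> t" "t \<le> 1"
  shows "x + t *\<^sub>R (y - x) \<in> almost_fixed C S n"
proof -
  define \<theta> where "\<theta> = 1 / (16 * real d * (real n)\<^sup>2)"
  define r where "r = norm (y - x)"
  define z where "z = x + t *\<^sub>R (y - x)"
  have xy: "x \<in> C" "y \<in> C" "norm (S x - x) \<le> \<theta>" "norm (S y - y) \<le> \<theta>"
    using x y by (auto simp: almost_fixed_def \<theta>_def)
  have z_eq: "z = (1 - t) *\<^sub>R x + t *\<^sub>R y" by (simp add: z_def algebra_simps)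
  have z: "z \<in> C" unfolding z_eq using C(1) xy t by (intro convexD) auto
  have r: "0 \<le> r" "r \<le> d" using C(2)[of y x] xy by (auto simp: r_def)
  have "16 * 1 * 1 \<le> 16 * real d * (real n)\<^sup>2" using d n by (intro mult_mono) auto
  hence \<theta>: "0 < \<theta>" "\<theta> \<le> 1" by (auto simp: \<theta>_def)
  have "norm (z - x) = t * r" using t by (simp add: z_def r_def)
  moreover have "z - y = (1 - t) *\<^sub>R (x - y)" by (simp add: z_eq algebra_simps)
  hence "norm (z - y) = (1 - t) * r" using t by (simp add: r_def norm_minus_commute)
  ultimately have zx: "norm (S z - x) \<le> t * r + \<theta>" and zy: "norm (S z - y) \<le> (1 - t) * r + \<theta>"
    using norm_triangle_ineq[of "S z - S x" "S x - x"] norm_triangle_ineq[of "S z - S y" "S y - y"]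
      S[OF z xy(1)] S[OF z xy(2)] xy by simp_all
  have "S z - z = (1 - t) *\<^sub>R (S z - x) + t *\<^sub>R (S z - y)" by (simp add: z_eq algebra_simps)
  moreover have "y - x = (S z - x) - (S z - y)" by simp
  ultimately have "(norm (S z - z))\<^sup>2
      = (1 - t) * (norm (S z - x))\<^sup>2 + t * (norm (S z - y))\<^sup>2 - t * (1 - t) * r\<^sup>2"
    unfolding power2_norm_eq_inner r_def
    by (simp only: inner_diff_left inner_diff_right inner_add_left inner_add_right
          inner_scaleR_left inner_scaleR_right) (simp add: inner_commute algebra_simps)
  also have "\<dots> \<le> (1 - t) * (t * r + \<theta>)\<^sup>2 + t * ((1 - t) * r + \<theta>)\<^sup>2 - t * (1 - t) * r\<^sup>2"
    using t zx zy r by (intro diff_mono add_mono mult_left_mono power_mono) auto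
  also have "\<dots> = 4 * (t * (1 - t)) * (\<theta> * r) + \<theta>\<^sup>2"
    by (simp add: power2_eq_square algebra_simps)
  also have "\<dots> \<le> 4 * 1 * (\<theta> * d) + \<theta> * d"
    using t \<theta> r d by (intro add_mono mult_mono) (auto simp: power2_eq_square mult_le_one)
  also have "\<dots> = 5 / 16 * (1 / real n)\<^sup>2" using d n by (simp add: \<theta>_def power2_eq_square field_simps)
  also have "\<dots> < (1 / real n)\<^sup>2" using n by simp
  finally have "norm (S z - z) < 1 / real n" by (rule power2_less_imp_less) simp
  thus ?thesis using z by (simp add: almost_fixed_def z_def)
qed

lemma parameter_bounds:
  fixes d :: nat
  assumes d: "1 \<le> d" and \<tau>: "0 < \<tau>" "\<tau> < 1" and \<epsilon>: "0 < \<epsilon>" "\<epsilon> \<le> real d"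
  defines "et \<equiv> eps_tilde d \<tau> \<epsilon>" and "\<delta>\<^sub>0 \<equiv> (1 - \<tau>) * \<epsilon>\<^sup>2 / 96"
  shows "0 < et" "8 * real d * et \<le> (1 - \<tau>)\<^sup>2 * (\<delta>\<^sub>0\<^sup>2 / (2 * (real d)\<^sup>2))"
    "0 < \<delta>\<^sub>0" "96 * \<delta>\<^sub>0 \<le> (real d)\<^sup>2"
    "\<tau> ^ Suc (i_zero d \<tau> \<epsilon>) * (real d)\<^sup>2 \<le> et / 6"
    "8 * real d ^ 4 / et ^ 4 \<le> real (N_zero d \<tau> \<epsilon>)"
proof -
  have \<delta>0: "0 < \<delta>\<^sub>0" using \<tau> \<epsilon> by (simp add: \<delta>\<^sub>0_def)
  thus "0 < \<delta>\<^sub>0" .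
  have et: "et = (1 - \<tau>)\<^sup>2 / (6 + 8 * real d) * (\<delta>\<^sub>0\<^sup>2 / (2 * (real d)\<^sup>2))"
    by (simp add: et_def \<delta>\<^sub>0_def eps_tilde_def eps_d_def)
  show pos: "0 < et" using \<delta>0 \<tau> d by (simp add: et)
  have "8 * real d * et \<le> (6 + 8 * real d) * et" using pos by (intro mult_right_mono) auto
  also have "\<dots> = (1 - \<tau>)\<^sup>2 * (\<delta>\<^sub>0\<^sup>2 / (2 * (real d)\<^sup>2))"
    using d by (simp add: et add_nonneg_eq_0_iff)
  finally show "8 * real d * et \<le> (1 - \<tau>)\<^sup>2 * (\<delta>\<^sub>0\<^sup>2 / (2 * (real d)\<^sup>2))" .
  have "(1 - \<tau>) * \<epsilon>\<^sup>2 \<le> 1 * (real d)\<^sup>2" using \<tau> \<epsilon> by (intro mult_mono power_mono) auto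
  thus "96 * \<delta>\<^sub>0 \<le> (real d)\<^sup>2" by (simp add: \<delta>\<^sub>0_def)
  define q where "q = et / (6 * (real d)\<^sup>2)"
  have q: "0 < q" using pos d by (simp add: q_def)
  have "log \<tau> q - 1 \<le> real (i_zero d \<tau> \<epsilon>)"
    unfolding i_zero_def et_def[symmetric] q_def[symmetric] by linarith
  hence "\<tau> powr real (Suc (i_zero d \<tau> \<epsilon>)) \<le> \<tau> powr (log \<tau> q)"
    using \<tau> by (intro powr_mono') auto
  also have "\<dots> = q" using \<tau> q by simp
  finally have "\<tau> ^ Suc (i_zero d \<tau> \<epsilon>) \<le> q" using \<tau> by (subst (asm) powr_realpow) auto
  hence "\<tau> ^ Suc (i_zero d \<tau> \<epsilon>) * (real d)\<^sup>2 \<le> q * (real d)\<^sup>2" by (intro mult_right_mono) auto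
  also have "\<dots> = et / 6" using d by (simp add: q_def)
  finally show "\<tau> ^ Suc (i_zero d \<tau> \<epsilon>) * (real d)\<^sup>2 \<le> et / 6" .
  show "8 * real d ^ 4 / et ^ 4 \<le> real (N_zero d \<tau> \<epsilon>)"
    unfolding N_zero_def et_def by (rule real_nat_ceiling_ge)
qed

text \<open>
  About \<open>(d / eps_tilde)\<^sup>2\<close> comparisons per projection achieve the accuracy needed, while \<open>N_zero\<close> is of
  the order of the fourth power of the same quotient.  So the number of comparisons is only about the
  square root of \<open>N_zero\<close>, and this surplus pays for all the nesting of searches.
\<close>

lemma minimization_steps:
  fixes d :: nat
  assumes d: "1 \<le> d" and \<tau>: "0 < \<tau>" "\<tau> < 1" and \<epsilon>: "0 < \<epsilon>" "\<epsilon> \<le> real d"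
  defines "\<delta>\<^sub>0 \<equiv> (1 - \<tau>) * \<epsilon>\<^sup>2 / 96"
  obtains M :: nat where "1 \<le> M" "(M + 1)\<^sup>2 \<le> N_zero d \<tau> \<epsilon>"
    "(real d)\<^sup>2 / sqrt M + \<tau> ^ Suc (i_zero d \<tau> \<epsilon>) * (real d)\<^sup>2
       + \<tau> * real d * sqrt (2 * ((real d)\<^sup>2 / sqrt M)) / (1 - \<tau>) \<le> \<delta>\<^sub>0"
proof -
  define et where "et = eps_tilde d \<tau> \<epsilon>"
  note par = parameter_bounds[OF d \<tau> \<epsilon>, folded et_def \<delta>\<^sub>0_def]
  define a where "a = (real d / et)\<^sup>2"
  have dpos: "0 < real d" using d by simp
  have "(1 - \<tau>)\<^sup>2 * (\<delta>\<^sub>0\<^sup>2 / (2 * (real d)\<^sup>2)) \<le> 1 * (\<delta>\<^sub>0\<^sup>2 / (2 * (real d)\<^sup>2))"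
    using \<tau> by (intro mult_right_mono) (auto simp: power_le_one)
  also have "\<delta>\<^sub>0 * \<delta>\<^sub>0 \<le> (real d)\<^sup>2 / 96 * \<delta>\<^sub>0" using par by (intro mult_right_mono) auto
  hence "\<delta>\<^sub>0\<^sup>2 / (2 * (real d)\<^sup>2) \<le> \<delta>\<^sub>0 / 192"
    using dpos by (simp add: field_simps power2_eq_square)
  finally have et_small: "8 * (real d * et) \<le> \<delta>\<^sub>0 / 192" using par(2) by linarith
  have "real d * (8 * 192 * 96 * et) \<le> real d * real d"
    using et_small par(4) by (simp add: power2_eq_square)
  hence "8 * 192 * 96 * et \<le> real d" using dpos by (simp only: mult_le_cancel_left_pos)
  hence "6 \<le> real d / et" using par(1) by (simp add: field_simps)
  hence "6\<^sup>2 \<le> a" unfolding a_def by (intro power_mono) auto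
  hence a: "36 \<le> a" by simp
  define M where "M = nat \<lceil>a\<rceil>"
  have M: "a \<le> real M" "real M \<le> a + 1" using a by (auto simp: M_def)
  have M1: "1 \<le> M" using M a by linarith
  have "(real M + 1)\<^sup>2 \<le> (2 * a)\<^sup>2" using M a by (intro power_mono) auto
  also have "\<dots> \<le> 8 * a\<^sup>2" by simp
  also have "\<dots> = 8 * real d ^ 4 / et ^ 4" by (simp add: a_def power_divide flip: power_mult)
  also have "\<dots> \<le> real (N_zero d \<tau> \<epsilon>)" by (rule par(6))
  finally have "real ((M + 1)\<^sup>2) \<le> real (N_zero d \<tau> \<epsilon>)" by (simp add: add.commute)
  hence N: "(M + 1)\<^sup>2 \<le> N_zero d \<tau> \<epsilon>" by linarith
  have "real d / et \<le> sqrt M" using M(1) by (intro real_le_rsqrt) (simp add: a_def)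
  hence "(real d)\<^sup>2 / sqrt M \<le> (real d)\<^sup>2 / (real d / et)"
    using dpos par(1) M1 by (intro divide_left_mono) auto
  hence \<delta>: "(real d)\<^sup>2 / sqrt M \<le> real d * et" using dpos by (simp add: power2_eq_square)
  have "2 * ((real d)\<^sup>2 / sqrt M) \<le> ((1 - \<tau>) * \<delta>\<^sub>0 / (2 * real d))\<^sup>2"
  proof -
    define A where "A = (1 - \<tau>)\<^sup>2 * (\<delta>\<^sub>0\<^sup>2 / (2 * (real d)\<^sup>2))"
    have "0 < real d * et" using dpos par(1) by simp
    moreover have "8 * (real d * et) \<le> A" using par(2) by (simp add: A_def)
    ultimately have "2 * ((real d)\<^sup>2 / sqrt M) \<le> A / 2" using \<delta> by linarith
    also have "A / 2 = ((1 - \<tau>) * \<delta>\<^sub>0 / (2 * real d))\<^sup>2"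
      by (simp add: A_def power_mult_distrib power_divide)
    finally show ?thesis .
  qed
  hence "sqrt (2 * ((real d)\<^sup>2 / sqrt M)) \<le> (1 - \<tau>) * \<delta>\<^sub>0 / (2 * real d)"
    using \<tau> par(3) by (intro real_le_lsqrt) auto
  hence "\<tau> * real d * sqrt (2 * ((real d)\<^sup>2 / sqrt M)) / (1 - \<tau>)
      \<le> 1 * real d * ((1 - \<tau>) * \<delta>\<^sub>0 / (2 * real d)) / (1 - \<tau>)"
    using \<tau> by (intro divide_right_mono mult_mono) auto
  also have "\<dots> = \<delta>\<^sub>0 / 2" using \<tau> dpos by (simp add: field_simps)
  finally have e: "\<tau> * real d * sqrt (2 * ((real d)\<^sup>2 / sqrt M)) / (1 - \<tau>) \<le> \<delta>\<^sub>0 / 2" .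
  have "1 * et \<le> real d * et" using d par(1) by (intro mult_right_mono) auto
  hence "(real d)\<^sup>2 / sqrt M + \<tau> ^ Suc (i_zero d \<tau> \<epsilon>) * (real d)\<^sup>2
       + \<tau> * real d * sqrt (2 * ((real d)\<^sup>2 / sqrt M)) / (1 - \<tau>) \<le> \<delta>\<^sub>0"
    using \<delta> e par(5) par(3) et_small by linarith
  thus ?thesis using that M1 N by blast
qed

text \<open>
  The finitary counterpart of the fixed point of \<open>P \<circ> G\<close>: the point \<open>x\<close> is as nearly fixed as the given
  \<open>f\<close> demands and satisfies the variational inequality against all points that are fixed up to
  \<open>1 / k\<close>.  The \<open>i + 1\<close> projections use up at most \<open>(M + 1) ^ (i + 1)\<close> positions of the tower, where
  \<open>(M + 1)\<^sup>2 \<le> N\<^sub>0\<close>; as \<open>i + 1 \<le> 2 * max 1 i\<close>, this stays below \<open>N\<^sub>0 ^ max 1 i\<close>.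
\<close>

lemma quantitative_fixed_point_of_projection_after_contraction:
  fixes C :: "'a::real_inner set" and d :: nat
  assumes C: "convex C" "\<And>x y. x \<in> C \<Longrightarrow> y \<in> C \<Longrightarrow> norm (x - y) \<le> real d" and d: "1 \<le> d"
    and S: "\<And>x y. x \<in> C \<Longrightarrow> y \<in> C \<Longrightarrow> norm (S x - S y) \<le> norm (x - y)"
    and p: "p \<in> C" "S p = p"
    and G_in: "\<And>x. x \<in> C \<Longrightarrow> G x \<in> C"
    and G: "\<And>x y. x \<in> C \<Longrightarrow> y \<in> C \<Longrightarrow> norm (G x - G y) \<le> \<tau> * norm (x - y)"
    and \<tau>: "0 < \<tau>" "\<tau> < 1" and \<epsilon>: "0 < \<epsilon>" "\<epsilon> \<le> real d"
    and f: "\<And>k. 1 \<le> k \<Longrightarrow> 1 \<le> f k"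
  obtains k x where "1 \<le> k" "k \<le> k_seq d (N_zero d \<tau> \<epsilon>) f (i_zero d \<tau> \<epsilon>)"
    "x \<in> almost_fixed C S (f k)"
    "\<And>y. y \<in> almost_fixed C S k \<Longrightarrow> (G x - x) \<bullet> (y - x) \<le> (1 - \<tau>) * \<epsilon>\<^sup>2 / 96"
proof -
  define c where "c = tower d f"
  define N\<^sub>0 where "N\<^sub>0 = N_zero d \<tau> \<epsilon>"
  define i where "i = i_zero d \<tau> \<epsilon>"
  have c: "1 \<le> c m" for m using tower_ge_1[OF d] by (simp add: c_def)
  have sq: "c m \<le> 16 * d * (c m)\<^sup>2" "16 * d * (c m)\<^sup>2 \<le> c (Suc m)" for m
    using le_square_arg[OF d] ftilde_ge_square by (auto simp: c_def tower_Suc)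
  have sq1: "1 \<le> 16 * d * (c m)\<^sup>2" for m using sq(1)[of m] c[of m] by linarith
  interpret segment_filtration "\<lambda>m. almost_fixed C S (c m)"
    "\<lambda>m. almost_fixed C S (16 * d * (c m)\<^sup>2)" "real d" p
  proof
    show "p \<in> almost_fixed C S (c m)" for m using p c[of m] by (simp add: almost_fixed_def)
    show "norm (x - y) \<le> real d" if "x \<in> almost_fixed C S (c 0)" "y \<in> almost_fixed C S (c 0)" for x y
      using that C(2) by (simp add: almost_fixed_def)
    show "x + t *\<^sub>R (y - x) \<in> almost_fixed C S (c m)"
      if "x \<in> almost_fixed C S (16 * d * (c m)\<^sup>2)" "y \<in> almost_fixed C S (16 * d * (c m)\<^sup>2)"
        "0 \<le> t" "t \<le> 1" for x y t m
      using segment_almost_fixed[OF C d S c that] .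
  qed (intro almost_fixed_antimono sq c sq1)+
  obtain M where M: "1 \<le> M" "(M + 1)\<^sup>2 \<le> N\<^sub>0"
    "(real d)\<^sup>2 / sqrt M + \<tau> ^ Suc i * (real d)\<^sup>2
       + \<tau> * real d * sqrt (2 * ((real d)\<^sup>2 / sqrt M)) / (1 - \<tau>) \<le> (1 - \<tau>) * \<epsilon>\<^sup>2 / 96"
    using minimization_steps[OF d \<tau> \<epsilon>] unfolding N\<^sub>0_def i_def by blast
  have "\<exists>n < (M + 1) ^ Suc i. \<exists>z \<in> almost_fixed C S (c (Suc n)).
    \<forall>y\<in>almost_fixed C S (16 * d * (c n)\<^sup>2).
      (G z - z) \<bullet> (y - z) \<le> (real d)\<^sup>2 / sqrt M + \<tau> ^ Suc i * (real d)\<^sup>2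
        + \<tau> * real d * sqrt (2 * ((real d)\<^sup>2 / sqrt M)) / (1 - \<tau>)"
    using C(2) G_in p G by (intro approximate_variational_inequality \<tau> M) (auto simp: almost_fixed_def)
  then obtain n z where n: "n < (M + 1) ^ Suc i" and z: "z \<in> almost_fixed C S (c (Suc n))"
    and vi: "\<And>y. y \<in> almost_fixed C S (16 * d * (c n)\<^sup>2) \<Longrightarrow> (G z - z) \<bullet> (y - z) \<le> (1 - \<tau>) * \<epsilon>\<^sup>2 / 96"
    using M(3) by (meson order_trans)
  define k where "k = 16 * d * (c n)\<^sup>2"
  have k: "1 \<le> k" using sq1 by (simp add: k_def)
  have "f k \<le> c (Suc n)"
    unfolding c_def tower_Suc using k by (intro ftilde_ge_fun) (auto simp: k_def c_def)
  hence zf: "z \<in> almost_fixed C S (f k)" using z almost_fixed_antimono[of "f k" "c (Suc n)"] f[OF k] by blast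
  have "(M + 1) ^ Suc i \<le> (M + 1) ^ (2 * max 1 i)" by (intro power_increasing) auto
  also have "\<dots> = ((M + 1)\<^sup>2) ^ max 1 i" by (simp add: power_mult)
  also have "\<dots> \<le> N\<^sub>0 ^ max 1 i" using M(2) by (intro power_mono) auto
  finally have "Suc n \<le> N\<^sub>0 ^ max 1 i" using n by linarith
  hence "c (Suc n) \<le> c (N\<^sub>0 ^ max 1 i)" unfolding c_def by (intro tower_mono d)
  hence "k \<le> k_seq d N\<^sub>0 f i"
    using sq(2)[of n] tower_le_k_seq[OF d, of f N\<^sub>0 i] by (simp add: k_def c_def)
  thus ?thesis using that[of k z] k zf vi by (simp add: k_def N\<^sub>0_def i_def)
qed

section \<open>The cyclic viscosity iteration\<close>

lemma cyc_in: "1 \<le> N \<Longrightarrow> cyc N n \<in> {1..N}"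
  using mod_less_divisor[of N n] by (auto simp: cyc_def mod_greater_zero_iff_not_dvd less_imp_le Suc_le_eq)

lemma cyc_id: "i \<in> {1..N} \<Longrightarrow> cyc N i = i"
  using nat_dvd_not_less[of i N] by (cases "i = N") (auto simp: cyc_def)

lemma cyc_add: "cyc N (n + N) = cyc N n"
  by (simp add: cyc_def)

text \<open>
  The left-hand side does not decrease in \<open>b\<close>, because shifting the block by one exchanges \<open>lam b\<close> for
  \<open>lam (b + N)\<close>, and in the limit the block vanishes.  So a bound on the variation controls a whole
  block of step sizes.
\<close>

lemma block_sum_le_tail_variation:
  fixes lam :: "nat \<Rightarrow> real"
  assumes lim: "lam \<longlonglongrightarrow> 0" and sm: "summable (\<lambda>i. \<bar>lam (i + N) - lam i\<bar>)" and "s \<le> b"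
  shows "(\<Sum>i=s..<b. \<bar>lam (i + N) - lam i\<bar>) + (\<Sum>i=b..<b+N. lam i)
    \<le> (\<Sum>i. \<bar>lam (s + i + N) - lam (s + i)\<bar>)"
proof -
  define f where "f i = \<bar>lam (i + N) - lam i\<bar>" for i
  define F where "F j = (\<Sum>i<j. f (s + i)) + (\<Sum>i<N. lam (s + j + i))" for j
  have shift: "(\<Sum>i=b..<b+N. lam i) = (\<Sum>i<N. lam (b + i))" for b
    using sum.shift_bounds_nat_ivl[of lam 0 b N] by (simp add: lessThan_atLeast0 add.commute)
  have "F j \<le> F (Suc j)" for j
  proof -
    have "(\<Sum>i<N. lam (Suc (s + j + i))) + lam (s + j) = (\<Sum>i<N. lam (s + j + i)) + lam (s + j + N)"
      using sum.lessThan_Suc[of "\<lambda>i. lam (s + j + i)" N]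
        sum.lessThan_Suc_shift[of "\<lambda>i. lam (s + j + i)" N] by simp
    thus ?thesis by (simp add: F_def f_def)
  qed
  hence "incseq F" by (rule incseq_SucI)
  moreover have "F \<longlonglongrightarrow> (\<Sum>i. f (s + i)) + (\<Sum>i<N. 0)"
    unfolding F_def
  proof (intro tendsto_add tendsto_sum)
    have "summable (\<lambda>i. f (s + i))"
      using summable_ignore_initial_segment[OF sm, of s] by (simp add: f_def add.commute)
    thus "(\<lambda>j. \<Sum>i<j. f (s + i)) \<longlonglongrightarrow> (\<Sum>i. f (s + i))" by (rule summable_LIMSEQ)
    show "(\<lambda>j. lam (s + j + i)) \<longlonglongrightarrow> 0" for i
      using LIMSEQ_ignore_initial_segment[OF lim, of "s + i"] by (simp add: ac_simps)
  qed
  ultimately have "F (b - s) \<le> (\<Sum>i. f (s + i))" using incseq_le by force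
  moreover have "(\<Sum>i=s..<b. f i) = (\<Sum>i<b - s. f (s + i))"
    using sum.shift_bounds_nat_ivl[of f 0 s "b - s"] \<open>s \<le> b\<close>
    by (simp add: lessThan_atLeast0 add.commute)
  ultimately show ?thesis using \<open>s \<le> b\<close> by (simp add: F_def f_def shift)
qed

locale cyclic_viscosity_iteration =
  fixes C :: "'a::real_inner set" and T :: "nat \<Rightarrow> 'a \<Rightarrow> 'a" and G :: "'a \<Rightarrow> 'a"
    and u :: "nat \<Rightarrow> 'a" and N :: nat and D \<tau> :: real and lam :: "nat \<Rightarrow> real"
  assumes C_convex: "convex C"
    and bound: "x \<in> C \<Longrightarrow> y \<in> C \<Longrightarrow> norm (x - y) \<le> D"
    and N_pos: "1 \<le> N"
    and T_in: "i \<in> {1..N} \<Longrightarrow> x \<in> C \<Longrightarrow> T i x \<in> C"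
    and T_nonexpansive:
      "i \<in> {1..N} \<Longrightarrow> x \<in> C \<Longrightarrow> y \<in> C \<Longrightarrow> norm (T i x - T i y) \<le> norm (x - y)"
    and G_in: "x \<in> C \<Longrightarrow> G x \<in> C"
    and G_contraction: "x \<in> C \<Longrightarrow> y \<in> C \<Longrightarrow> norm (G x - G y) \<le> \<tau> * norm (x - y)"
    and \<tau>: "0 < \<tau>" "\<tau> < 1"
    and lam: "0 \<le> lam n" "lam n \<le> 1"
    and u_0: "u 0 \<in> C"
    and u_Suc: "u (Suc n) = (1 - lam (Suc n)) *\<^sub>R T (cyc N (Suc n)) (u n)
      + lam (Suc n) *\<^sub>R G (T (cyc N (Suc n)) (u n))"
begin

lemma T_cyc_in: "x \<in> C \<Longrightarrow> T (cyc N n) x \<in> C"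
  using T_in cyc_in[OF N_pos] by blast

lemma T_cyc_nonexpansive:
  "x \<in> C \<Longrightarrow> y \<in> C \<Longrightarrow> norm (T (cyc N n) x - T (cyc N n) y) \<le> norm (x - y)"
  using T_nonexpansive cyc_in[OF N_pos] by blast

lemma u_in: "u n \<in> C"
proof (induction n)
  case (Suc n)
  show ?case
    unfolding u_Suc using lam[of "Suc n"] by (intro convexD[OF C_convex] T_cyc_in G_in Suc) auto
qed (rule u_0)

lemma D_nonneg: "0 \<le> D"
  using bound[OF u_0 u_0] by simp

lemma rate_factor: "0 \<le> 1 - lam n * (1 - \<tau>)" "1 - lam n * (1 - \<tau>) \<le> 1"
proof -
  have "lam n * (1 - \<tau>) \<le> 1" using lam[of n] \<tau> by (intro mult_le_one) auto
  thus "0 \<le> 1 - lam n * (1 - \<tau>)" "1 - lam n * (1 - \<tau>) \<le> 1" using lam[of n] \<tau> by auto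
qed

lemma rate_prod_nonneg: "0 \<le> (\<Prod>i\<in>A. 1 - lam i * (1 - \<tau>))"
  using rate_factor by (intro prod_nonneg) auto

lemma viscosity_step:
  assumes "x \<in> C" "y \<in> C"
  shows "norm ((1 - lam n) *\<^sub>R (x - y) + lam n *\<^sub>R (G x - G y)) \<le> (1 - lam n * (1 - \<tau>)) * norm (x - y)"
proof -
  have "norm ((1 - lam n) *\<^sub>R (x - y) + lam n *\<^sub>R (G x - G y))
      \<le> (1 - lam n) * norm (x - y) + lam n * norm (G x - G y)"
    using norm_triangle_ineq[of "(1 - lam n) *\<^sub>R (x - y)" "lam n *\<^sub>R (G x - G y)"] lam[of n] by simp
  also have "\<dots> \<le> (1 - lam n) * norm (x - y) + lam n * (\<tau> * norm (x - y))"
    using lam[of n] G_contraction[OF assms] by (intro add_left_mono mult_left_mono) auto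
  finally show ?thesis by (simp add: algebra_simps)
qed

text \<open>
  At indices that differ by \<open>N\<close> the same map of the family is applied, so the two iterates approach each
  other at the rate of the contraction, up to the difference of the step sizes.
\<close>

lemma lagged_difference_step:
  "norm (u (Suc m + N) - u (Suc m))
    \<le> (1 - lam (Suc m) * (1 - \<tau>)) * norm (u (m + N) - u m) + \<bar>lam (Suc m + N) - lam (Suc m)\<bar> * D"
proof -
  define w where "w = T (cyc N (Suc m)) (u m)"
  define w' where "w' = T (cyc N (Suc m)) (u (m + N))"
  have w: "w \<in> C" "w' \<in> C" by (simp_all add: w_def w'_def T_cyc_in u_in)
  have "u (Suc m + N) = (1 - lam (Suc m + N)) *\<^sub>R w' + lam (Suc m + N) *\<^sub>R G w'"
    using u_Suc[of "m + N"] cyc_add[of N "Suc m"] by (simp add: w'_def)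
  hence "u (Suc m + N) - u (Suc m) = ((1 - lam (Suc m)) *\<^sub>R (w' - w) + lam (Suc m) *\<^sub>R (G w' - G w))
      + (lam (Suc m + N) - lam (Suc m)) *\<^sub>R (G w' - w')"
    using u_Suc[of m] by (simp add: w_def[symmetric] algebra_simps)
  hence "norm (u (Suc m + N) - u (Suc m))
      \<le> (1 - lam (Suc m) * (1 - \<tau>)) * norm (w' - w) + \<bar>lam (Suc m + N) - lam (Suc m)\<bar> * norm (G w' - w')"
    using norm_triangle_ineq[of "(1 - lam (Suc m)) *\<^sub>R (w' - w) + lam (Suc m) *\<^sub>R (G w' - G w)"
        "(lam (Suc m + N) - lam (Suc m)) *\<^sub>R (G w' - w')"] viscosity_step[OF w(2,1), of "Suc m"] by simp
  also have "\<dots> \<le> (1 - lam (Suc m) * (1 - \<tau>)) * norm (u (m + N) - u m)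
      + \<bar>lam (Suc m + N) - lam (Suc m)\<bar> * D"
    using rate_factor[of "Suc m"] bound[OF G_in[OF w(2)] w(2)]
      T_cyc_nonexpansive[OF u_in u_in, of "Suc m" "m + N" m]
    by (intro add_mono mult_left_mono) (auto simp: w_def w'_def)
  finally show ?thesis .
qed

lemma lagged_difference_bound:
  assumes "s \<le> m"
  shows "norm (u (m + N) - u m)
    \<le> D * (\<Prod>i=Suc s..m. 1 - lam i * (1 - \<tau>)) + D * (\<Sum>i=Suc s..m. \<bar>lam (i + N) - lam i\<bar>)"
  using assms
proof (induction rule: dec_induct)
  case base
  show ?case using bound[OF u_in u_in] by simp
next
  case (step m)
  define q where "q = 1 - lam (Suc m) * (1 - \<tau>)"
  define P where "P = (\<Prod>i=Suc s..m. 1 - lam i * (1 - \<tau>))"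
  define V where "V = (\<Sum>i=Suc s..m. \<bar>lam (i + N) - lam i\<bar>)"
  have q: "0 \<le> q" "q \<le> 1" using rate_factor by (auto simp: q_def)
  have V: "0 \<le> D * V" using D_nonneg by (auto simp: V_def sum_nonneg)
  have "q * norm (u (m + N) - u m) \<le> q * (D * P + D * V)"
    using step.IH q by (intro mult_left_mono) (auto simp: P_def V_def)
  also have "\<dots> \<le> D * (P * q) + D * V"
    using mult_right_mono[OF q(2) V] by (simp add: algebra_simps)
  finally show ?case
    using lagged_difference_step[of m] step.hyps
    by (simp add: P_def V_def q_def distrib_left mult.commute[of D "\<bar>_\<bar>"])
qed

text \<open>
  Each step applies a nonexpansive map and then moves by at most \<open>lam * D\<close>, and the later maps do not
  enlarge this error.
\<close>

lemma drift_from_composition: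
  defines "Z n j \<equiv> fold (\<lambda>i. T (cyc N (i + n))) [1..<Suc j] (u n)"
  shows "Z n j \<in> C \<and> norm (u (n + j) - Z n j) \<le> D * (\<Sum>i=Suc n..n+j. lam i)"
proof (induction j)
  case 0
  show ?case by (simp add: Z_def u_in)
next
  case (Suc j)
  define w where "w = T (cyc N (Suc (n + j))) (u (n + j))"
  have w: "w \<in> C" by (simp add: w_def T_cyc_in u_in)
  have Z: "Z n (Suc j) = T (cyc N (Suc (n + j))) (Z n j)" by (simp add: Z_def add.commute)
  have "u (Suc (n + j)) = (1 - lam (Suc (n + j))) *\<^sub>R w + lam (Suc (n + j)) *\<^sub>R G w"
    using u_Suc by (simp add: w_def)
  hence "u (n + Suc j) - Z n (Suc j) = (w - Z n (Suc j)) + lam (Suc (n + j)) *\<^sub>R (G w - w)"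
    unfolding add_Suc_right by (simp add: scaleR_diff_left scaleR_diff_right)
  hence "norm (u (n + Suc j) - Z n (Suc j))
      \<le> norm (w - Z n (Suc j)) + norm (lam (Suc (n + j)) *\<^sub>R (G w - w))"
    by (simp only: norm_triangle_ineq)
  also have "\<dots> = norm (w - Z n (Suc j)) + lam (Suc (n + j)) * norm (G w - w)" using lam by simp
  also have "\<dots> \<le> norm (u (n + j) - Z n j) + lam (Suc (n + j)) * D"
    using bound[OF G_in[OF w] w] lam Suc unfolding Z w_def
    by (intro add_mono mult_left_mono T_cyc_nonexpansive u_in) auto
  finally show ?case using Suc by (auto simp: Z T_cyc_in algebra_simps)
qed

text \<open>
  The displacement under a full cycle is at most the lagged difference plus the drift.  The
  variation spent up to \<open>m\<close> and the step sizes of the following block together cost at most one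
  tail of the variation, by the lemma on block sums.
\<close>

lemma asymptotic_regularity:
  assumes lim: "lam \<longlonglongrightarrow> 0" and sm: "summable (\<lambda>i. \<bar>lam (i + N) - lam i\<bar>)"
    and \<eta>: "0 < \<eta>" "\<eta> \<le> 1" and D: "1 \<le> D"
    and tail: "(\<Sum>i. \<bar>lam (s + i + N) - lam (s + i)\<bar>) \<le> \<eta> / (4 * D)"
    and decay: "(\<Prod>i=s..m. 1 - lam i * (1 - \<tau>)) \<le> \<eta> / (2 * D)" and "s \<le> m"
  shows "norm (compose_all N T (\<lambda>i. cyc N (i + m)) (u m) - u m) < \<eta>"
proof -
  define P where "P = (\<Prod>i=Suc s..m. 1 - lam i * (1 - \<tau>))"
  define V where "V = (\<Sum>i=Suc s..m. \<bar>lam (i + N) - lam i\<bar>)"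
  define B where "B = (\<Sum>i=Suc m..m+N. lam i)"
  have "\<bar>lam (s + N) - lam s\<bar> + V = (\<Sum>i=s..<Suc m. \<bar>lam (i + N) - lam i\<bar>)"
    unfolding V_def using sum.atLeast_Suc_atMost[OF \<open>s \<le> m\<close>, of "\<lambda>i. \<bar>lam (i + N) - lam i\<bar>"]
    by (simp add: atLeastLessThanSuc_atLeastAtMost)
  moreover have "B = (\<Sum>i=Suc m..<Suc m+N. lam i)"
    by (simp add: B_def atLeastLessThanSuc_atLeastAtMost)
  ultimately have VB: "V + B \<le> \<eta> / (4 * D)"
    using block_sum_le_tail_variation[OF lim sm, of s "Suc m"] tail \<open>s \<le> m\<close> by simp
  \<comment> \<open>The given product starts at \<open>s\<close>, but the factor at \<open>s\<close> belongs to a step that is already over;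
    the same control of blocks shows that removing it enlarges the product by at most the factor \<open>4 / 3\<close>.\<close>
  have "lam s \<le> (\<Sum>i=s..<s+N. lam i)" using lam N_pos by (intro member_le_sum) auto
  hence "lam s \<le> \<eta> / (4 * D)" using block_sum_le_tail_variation[OF lim sm, of s s] tail by simp
  also have "\<dots> \<le> 1 / 4" using \<eta> D by (simp add: field_simps)
  finally have "lam s * (1 - \<tau>) \<le> 1 / 4 * 1" using lam \<tau> by (intro mult_mono) auto
  hence "(3 / 4) * P \<le> (1 - lam s * (1 - \<tau>)) * P"
    using rate_prod_nonneg by (intro mult_right_mono) (auto simp: P_def)
  also have "\<dots> = (\<Prod>i=s..m. 1 - lam i * (1 - \<tau>))"
    unfolding P_def using \<open>s \<le> m\<close> by (simp add: prod.atLeast_Suc_atMost)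
  finally have "(3 / 4) * P \<le> \<eta> / (2 * D)" using decay by simp
  hence "D * P \<le> 2 / 3 * \<eta>" using D by (simp add: field_simps)
  moreover have "D * (V + B) \<le> \<eta> / 4" using VB D by (simp add: field_simps)
  moreover have "norm (compose_all N T (\<lambda>i. cyc N (i + m)) (u m) - u m) \<le> D * B + (D * P + D * V)"
    using norm_triangle_ineq4[of "u (m + N) - u m" "u (m + N) - compose_all N T (\<lambda>i. cyc N (i + m)) (u m)"]
      drift_from_composition[of m N] lagged_difference_bound[OF \<open>s \<le> m\<close>]
    by (simp add: B_def P_def V_def compose_all_def)
  ultimately show ?thesis using \<eta> by (simp add: distrib_left)
qed

text \<open>
  The descent estimate behind strong convergence.  A step contracts the squared distance to \<open>x\<close> by
  \<open>1 - lam * (1 - \<tau>)\<close> and adds \<open>2 * lam * \<delta>\<close> from the variational inequality, a convex combination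
  that never exceeds \<open>2 * \<delta> / (1 - \<tau>)\<close>.  That \<open>x\<close> is only nearly fixed costs \<open>3 * D * \<omega>\<close> per step, which
  accumulates and is therefore useful over a finite range only.
\<close>

lemma distance_to_approximate_solution:
  assumes x: "x \<in> C" and \<omega>: "\<And>i. i \<in> {1..N} \<Longrightarrow> norm (T i x - x) \<le> \<omega>" "\<omega> \<le> D"
    and \<delta>: "0 \<le> \<delta>" "\<And>n. a \<le> n \<Longrightarrow> (G x - x) \<bullet> (u n - x) \<le> \<delta>"
    and "a \<le> m"
  shows "(norm (u m - x))\<^sup>2 \<le> D\<^sup>2 * (\<Prod>i=Suc a..m. 1 - lam i * (1 - \<tau>)) + 2 * \<delta> / (1 - \<tau>)
    + real (m - a) * (3 * D * \<omega>)"
  using \<open>a \<le> m\<close>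
proof (induction rule: dec_induct)
  case base
  have "(norm (u a - x))\<^sup>2 \<le> D\<^sup>2" using bound[OF u_in x] by (intro power_mono) auto
  moreover have "0 \<le> 2 * \<delta> / (1 - \<tau>)" using \<delta> \<tau> by simp
  ultimately show ?case by simp
next
  case (step m)
  define l where "l = lam (Suc m)"
  define q where "q = 1 - l * (1 - \<tau>)"
  define w where "w = T (cyc N (Suc m)) (u m)"
  define A where "A = (1 - l) *\<^sub>R (w - x) + l *\<^sub>R (G w - G x)"
  define Q where "Q = D\<^sup>2 * (\<Prod>i=Suc a..m. 1 - lam i * (1 - \<tau>))"
  define c where "c = real (m - a) * (3 * D * \<omega>)"
  have q: "0 \<le> q" "q \<le> 1" using rate_factor by (auto simp: q_def l_def)
  have l: "0 \<le> l" using lam by (simp add: l_def)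
  have w: "w \<in> C" by (simp add: w_def T_cyc_in u_in)
  have "norm (T (cyc N (Suc m)) x - x) \<le> \<omega>" using \<omega>(1) cyc_in[OF N_pos] by blast
  moreover from this have \<omega>0: "0 \<le> \<omega>" using norm_ge_zero order_trans by blast
  ultimately have "norm (w - x) \<le> norm (u m - x) + \<omega>"
    using norm_triangle_ineq[of "w - T (cyc N (Suc m)) x" "T (cyc N (Suc m)) x - x"]
      T_cyc_nonexpansive[OF u_in x, of "Suc m" m] by (simp add: w_def)
  hence "(norm (w - x))\<^sup>2 \<le> (norm (u m - x) + \<omega>)\<^sup>2" by (intro power_mono) auto
  also have "\<dots> = (norm (u m - x))\<^sup>2 + (2 * norm (u m - x) + \<omega>) * \<omega>"
    by (simp add: power2_eq_square algebra_simps)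
  also have "\<dots> \<le> (norm (u m - x))\<^sup>2 + (3 * D) * \<omega>"
    using bound[OF u_in x, of m] \<omega>(2) \<omega>0 by (intro add_left_mono mult_right_mono) auto
  finally have w_le: "(norm (w - x))\<^sup>2 \<le> (norm (u m - x))\<^sup>2 + 3 * D * \<omega>" .
  have "norm A \<le> q * norm (w - x)" using viscosity_step[OF w x, of "Suc m"] by (simp add: A_def q_def l_def)
  hence "(norm A)\<^sup>2 \<le> (q * norm (w - x))\<^sup>2" by (intro power_mono) auto
  also have "\<dots> = q * (q * (norm (w - x))\<^sup>2)" by (simp add: power2_eq_square)
  also have "\<dots> \<le> 1 * (q * (norm (w - x))\<^sup>2)" using q by (intro mult_right_mono) auto
  also have "\<dots> \<le> q * ((norm (u m - x))\<^sup>2 + 3 * D * \<omega>)" using w_le q by (simp add: mult_left_mono)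
  also have "\<dots> \<le> q * (Q + 2 * \<delta> / (1 - \<tau>) + c + 3 * D * \<omega>)"
    using step.IH q by (intro mult_left_mono) (auto simp: Q_def c_def)
  also have "\<dots> \<le> Q * q + q * (2 * \<delta> / (1 - \<tau>)) + (c + 3 * D * \<omega>)"
    using mult_right_mono[OF q(2), of "c + 3 * D * \<omega>"] D_nonneg \<omega>0
    by (simp add: c_def algebra_simps)
  finally have A_le: "(norm A)\<^sup>2 \<le> Q * q + q * (2 * \<delta> / (1 - \<tau>)) + (c + 3 * D * \<omega>)" .
  have A_eq: "A = (u (Suc m) - x) - l *\<^sub>R (G x - x)"
    using u_Suc[of m] by (simp add: A_def w_def[symmetric] l_def[symmetric] algebra_simps)
  have "(norm A)\<^sup>2
      = (norm (u (Suc m) - x))\<^sup>2 - 2 * l * ((G x - x) \<bullet> (u (Suc m) - x)) + l\<^sup>2 * (norm (G x - x))\<^sup>2"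
    unfolding A_eq norm_diff_scaleR_squared by (simp add: inner_commute)
  hence "(norm (u (Suc m) - x))\<^sup>2 \<le> (norm A)\<^sup>2 + 2 * (l * ((G x - x) \<bullet> (u (Suc m) - x)))" by simp
  also have "l * ((G x - x) \<bullet> (u (Suc m) - x)) \<le> l * \<delta>" using \<delta>(2)[of "Suc m"] step.hyps l
    by (intro mult_left_mono) auto
  finally have "(norm (u (Suc m) - x))\<^sup>2 \<le> Q * q + (q * (2 * \<delta> / (1 - \<tau>)) + 2 * (l * \<delta>)) + (c + 3 * D * \<omega>)"
    using A_le by simp
  also have "q * (2 * \<delta> / (1 - \<tau>)) + 2 * (l * \<delta>) = 2 * \<delta> / (1 - \<tau>)"
    using \<tau> by (simp add: q_def field_simps)
  also have "Q * q = D\<^sup>2 * (\<Prod>i=Suc a..Suc m. 1 - lam i * (1 - \<tau>))"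
    using step.hyps by (simp add: Q_def q_def l_def)
  also have "c + 3 * D * \<omega> = real (Suc m - a) * (3 * D * \<omega>)"
    using step.hyps by (simp add: c_def Suc_diff_le algebra_simps)
  finally show ?case .
qed

end

section \<open>The rate of metastability\<close>

lemma Omega_min_le: "i \<le> n \<Longrightarrow> Omega_min \<phi>\<^sub>3 d \<eta> g n \<le> Omega \<phi>\<^sub>3 d \<eta> g i"
  unfolding Omega_min_def by (intro Min_le) auto

lemma Omega_pos: "1 \<le> d \<Longrightarrow> 0 < \<eta> \<Longrightarrow> 0 < Omega \<phi>\<^sub>3 d \<eta> g n"
  unfolding Omega_def by (intro divide_pos_pos mult_pos_pos) auto

lemma Omega_min_pos: "1 \<le> d \<Longrightarrow> 0 < \<eta> \<Longrightarrow> 0 < Omega_min \<phi>\<^sub>3 d \<eta> g n"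
  unfolding Omega_min_def by (subst Min_gr_iff) (auto intro: Omega_pos)

lemma chi_ceiling_bound:
  assumes chi: "\<And>k n. k \<ge> 1 \<Longrightarrow> n \<ge> chi k \<Longrightarrow> lam n \<le> 1 / real k"
    and "0 < c" and "n \<ge> chi (nat \<lceil>c\<rceil>)"
  shows "lam n \<le> 1 / c"
proof -
  have c: "c \<le> real (nat \<lceil>c\<rceil>)" by (rule real_nat_ceiling_ge)
  hence "1 \<le> nat \<lceil>c\<rceil>" using \<open>0 < c\<close> by (cases "nat \<lceil>c\<rceil>") auto
  hence "lam n \<le> 1 / real (nat \<lceil>c\<rceil>)" using chi assms(3) by blast
  also have "\<dots> \<le> 1 / c" using c \<open>0 < c\<close> by (intro divide_left_mono) auto
  finally show ?thesis .
qed

lemma compose_all_nonexpansive: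
  fixes C :: "'a::real_normed_vector set"
  assumes T: "\<And>i x. i \<in> {1..N} \<Longrightarrow> x \<in> C \<Longrightarrow> T i x \<in> C"
    and ne: "\<And>i x y. i \<in> {1..N} \<Longrightarrow> x \<in> C \<Longrightarrow> y \<in> C \<Longrightarrow> norm (T i x - T i y) \<le> norm (x - y)"
    and xy: "x \<in> C" "y \<in> C"
  shows "norm (compose_all N T id x - compose_all N T id y) \<le> norm (x - y)"
proof -
  have "norm (fold T is x - fold T is y) \<le> norm (x - y)"
    if "set is \<subseteq> {1..N}" "x \<in> C" "y \<in> C" for "is" x y
    using that
  proof (induction "is" arbitrary: x y)
    case (Cons i "is")
    have "norm (fold T is (T i x) - fold T is (T i y)) \<le> norm (T i x - T i y)"
      using Cons.prems T by (intro Cons.IH) auto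
    also have "\<dots> \<le> norm (x - y)" using Cons.prems by (intro ne) auto
    finally show ?case by simp
  qed simp
  moreover have "set [1..<Suc N] \<subseteq> {1..N}" by auto
  ultimately show ?thesis
    unfolding compose_all_def id_apply using xy by blast
qed

lemma compose_all_displacement:
  fixes C :: "'a::real_normed_vector set"
  assumes T: "\<And>i x. i \<in> {1..N} \<Longrightarrow> x \<in> C \<Longrightarrow> T i x \<in> C"
    and ne: "\<And>i x y. i \<in> {1..N} \<Longrightarrow> x \<in> C \<Longrightarrow> y \<in> C \<Longrightarrow> norm (T i x - T i y) \<le> norm (x - y)"
    and x: "x \<in> C" and e: "\<And>i. i \<in> {1..N} \<Longrightarrow> norm (T i x - x) < e" and N: "1 \<le> N"
  shows "norm (compose_all N T id x - x) < real N * e"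
proof -
  have "fold T [1..<Suc j] x \<in> C \<and> norm (fold T [1..<Suc j] x - x) \<le> (\<Sum>i=1..j. norm (T i x - x))"
    if "j \<le> N" for j
    using that
  proof (induction j)
    case (Suc j)
    define z where "z = fold T [1..<Suc j] x"
    have z: "z \<in> C" "norm (z - x) \<le> (\<Sum>i=1..j. norm (T i x - x))"
      using Suc by (auto simp: z_def simp del: upt_Suc)
    have j: "Suc j \<in> {1..N}" using Suc.prems by simp
    have "norm (T (Suc j) z - x) \<le> norm (z - x) + norm (T (Suc j) x - x)"
      using norm_triangle_ineq[of "T (Suc j) z - T (Suc j) x" "T (Suc j) x - x"] ne[OF j z(1) x] by simp
    moreover have "fold T [1..<Suc (Suc j)] x = T (Suc j) z" by (simp add: z_def)
    ultimately show ?case using z T[OF j z(1)] by (simp del: upt_Suc)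
  qed (simp add: x)
  hence "norm (compose_all N T id x - x) \<le> (\<Sum>i=1..N. norm (T i x - x))" by (simp add: compose_all_def)
  also have "\<dots> < (\<Sum>i=1..N. e)" using e N by (intro sum_strict_mono) auto
  finally show ?thesis by simp
qed

theorem theorem7p9:
  fixes C :: "'a::{real_inner, complete_space} set"
    and T :: "nat \<Rightarrow> 'a \<Rightarrow> 'a"
    and G :: "'a \<Rightarrow> 'a"
    and p :: 'a
    and u :: "nat \<Rightarrow> 'a"
    and N d :: nat
    and \<tau> :: real
    and lam :: "nat \<Rightarrow> real"
    and \<rho> :: "nat \<Rightarrow> real \<Rightarrow> real"
    and chi :: "nat \<Rightarrow> nat"
    and \<phi>\<^sub>3 :: "real \<Rightarrow> nat \<Rightarrow> nat"
    and \<phi>\<^sub>4 :: "real \<Rightarrow> nat"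
  assumes "C \<noteq> {}" and "closed C" and "convex C" and "bounded C"
    and "d \<ge> 1" and "diameter C \<le> real d"
    and "N \<ge> 1"
    and "\<And>i. i \<in> {1..N} \<Longrightarrow> T i \<in> C \<rightarrow> C"
    and "\<And>i. i \<in> {1..N} \<Longrightarrow> 1-lipschitz_on C (T i)"
    and "p \<in> (\<Inter>i\<in>{1..N}. Fix C (T i))"
    and "(\<Inter>i\<in>{1..N}. Fix C (T i)) = Fix C (compose_all N T id)"
    and "\<And>b \<epsilon>. \<epsilon> > 0 \<Longrightarrow> \<rho> b \<epsilon> > 0"
    and "\<And>b. mono_on {0<..} (\<rho> b)"
    and "\<And>b \<epsilon>. \<epsilon> > 0 \<Longrightarrow> \<rho> b \<epsilon> \<le> \<epsilon>"
    and "\<And>b x \<epsilon> \<pi> i. x \<in> C \<Longrightarrow> \<epsilon> > 0 \<Longrightarrow> cyclic_perm N \<pi> \<Longrightarrow> norm (x - p) \<le> real b \<Longrightarrow>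
           norm (compose_all N T \<pi> x - x) < \<rho> b \<epsilon> \<Longrightarrow> i \<in> {1..N} \<Longrightarrow> norm (T i x - x) < \<epsilon>"
    and "\<And>n. lam n \<in> {0<..1}"
    and "0 < \<tau>" and "\<tau> < 1" and "G \<in> C \<rightarrow> C" and "\<tau>-lipschitz_on C G"
    and "\<And>k n. k \<ge> 1 \<Longrightarrow> n \<ge> chi k \<Longrightarrow> lam n \<le> 1 / real k"
    and "\<And>\<epsilon> n. \<epsilon> > 0 \<Longrightarrow> \<phi>\<^sub>3 \<epsilon> n \<ge> n"
    and "\<And>\<epsilon> n m. \<epsilon> > 0 \<Longrightarrow> m \<ge> \<phi>\<^sub>3 \<epsilon> n \<Longrightarrow> (\<Prod>i=n..m. 1 - lam i * (1 - \<tau>)) \<le> \<epsilon>"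
    and "summable (\<lambda>i. \<bar>lam (i + N) - lam i\<bar>)"
    and "\<And>\<epsilon>. \<epsilon> > 0 \<Longrightarrow> (\<Sum>i. \<bar>lam (\<phi>\<^sub>4 \<epsilon> + i + N) - lam (\<phi>\<^sub>4 \<epsilon> + i)\<bar>) \<le> \<epsilon>"
    and "u 0 \<in> C"
    and "\<And>n. u (n + 1) = (1 - lam (n + 1)) *\<^sub>R T (cyc N (n + 1)) (u n)
                       + lam (n + 1) *\<^sub>R G (T (cyc N (n + 1)) (u n))"
  shows "\<forall>\<epsilon>>0. \<forall>g :: nat \<Rightarrow> nat.
    \<exists>n \<le> Xi chi \<phi>\<^sub>3 \<phi>\<^sub>4 \<rho> N d \<tau> \<epsilon> g. norm (u n - u (gtilde g n)) \<le> \<epsilon>"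
proof (intro allI impI)
  fix \<epsilon> :: real and g :: "nat \<Rightarrow> nat"
  assume \<epsilon>: "0 < \<epsilon>"
  note d = \<open>d \<ge> 1\<close> and N = \<open>N \<ge> 1\<close> and \<tau> = \<open>0 < \<tau>\<close> \<open>\<tau> < 1\<close> and chi = assms(21)
    and \<phi>3_ge = assms(22) and \<phi>3 = assms(23) and sm = assms(24) and \<phi>4 = assms(25)
    and \<rho>_pos = assms(12) and \<rho>_le = assms(14) and \<rho> = assms(15)
  have T_in: "T i x \<in> C" if "i \<in> {1..N}" "x \<in> C" for i x
    using assms(8)[OF that(1)] that(2) by auto
  have T_ne: "norm (T i x - T i y) \<le> norm (x - y)" if "i \<in> {1..N}" "x \<in> C" "y \<in> C" for i x y
    using lipschitz_onD[OF assms(9)[OF that(1)] that(2,3)] by (simp add: dist_norm)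
  have G_in: "G x \<in> C" if "x \<in> C" for x using assms(19) that by auto
  have G: "norm (G x - G y) \<le> \<tau> * norm (x - y)" if "x \<in> C" "y \<in> C" for x y
    using lipschitz_onD[OF assms(20) that] by (simp add: dist_norm)
  have diam: "norm (x - y) \<le> real d" if "x \<in> C" "y \<in> C" for x y
    using diameter_bounded_bound[OF \<open>bounded C\<close> that] assms(6) by (simp add: dist_norm)
  have lam: "0 \<le> lam n" "lam n \<le> 1" for n using assms(16)[of n] by auto
  have p: "p \<in> C" using assms(10) N by (auto simp: Fix_def)
  interpret cyclic_viscosity_iteration C T G u N "real d" \<tau> lam
    by unfold_locales (use assms(3,26,27) N T_in T_ne G_in G diam lam \<tau> in auto)
  show "\<exists>n \<le> Xi chi \<phi>\<^sub>3 \<phi>\<^sub>4 \<rho> N d \<tau> \<epsilon> g. norm (u n - u (gtilde g n)) \<le> \<epsilon>"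
  proof (cases "\<epsilon> \<le> real d")
    case False
    hence "norm (u 0 - u (gtilde g 0)) \<le> \<epsilon>" using diam[OF u_in u_in, of 0 "gtilde g 0"] by linarith
    thus ?thesis by blast
  next
    case True
    define S where "S = compose_all N T id"
    define \<Omega> where "\<Omega> = Omega_min \<phi>\<^sub>3 d (\<epsilon> / 2) (runmax UNIV (gtilde g))"
    define f where "f = f_fun chi \<phi>\<^sub>3 \<phi>\<^sub>4 \<rho> N d \<tau> \<epsilon> g"
    define K where "K = k_seq d (N_zero d \<tau> \<epsilon>) f (i_zero d \<tau> \<epsilon>)"
    define start where "start k = max (n_zero chi d \<tau> \<epsilon>)
           (chi_hat chi \<phi>\<^sub>3 \<phi>\<^sub>4 N d (\<rho> d (1 / (real N * real k))))" for k :: nat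
    define \<delta>\<^sub>0 where "\<delta>\<^sub>0 = (1 - \<tau>) * \<epsilon>\<^sup>2 / 96"
    have \<Omega>_pos: "0 < \<Omega> n" for n using Omega_min_pos[OF d] \<epsilon> by (simp add: \<Omega>_def)
    have f_eq: "f k = nat \<lceil>1 / \<rho> d (\<Omega> (start k))\<rceil>" for k
      by (simp add: f_def f_fun_def \<Omega>_def start_def)
    have f_ge: "1 / \<rho> d (\<Omega> (start k)) \<le> real (f k)" for k
      unfolding f_eq by (rule real_nat_ceiling_ge)
    have f_pos: "1 \<le> f k" for k
    proof -
      have "0 < 1 / \<rho> d (\<Omega> (start k))" using \<rho>_pos[OF \<Omega>_pos] by simp
      thus ?thesis using f_ge[of k] by (cases "f k") auto
    qed
    have S_ne: "norm (S x - S y) \<le> norm (x - y)" if "x \<in> C" "y \<in> C" for x y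
      unfolding S_def using T_in T_ne that by (rule compose_all_nonexpansive)
    have "p \<in> Fix C S" using assms(10) unfolding assms(11) S_def .
    hence S_p: "S p = p" by (simp add: Fix_def)
    obtain k x where k: "1 \<le> k" "k \<le> K" and x_fix: "x \<in> almost_fixed C S (f k)"
      and vi: "\<And>y. y \<in> almost_fixed C S k \<Longrightarrow> (G x - x) \<bullet> (y - x) \<le> \<delta>\<^sub>0"
      by (rule quantitative_fixed_point_of_projection_after_contraction[where f = f,
        OF assms(3) diam d S_ne p S_p G_in G \<tau> \<epsilon> True f_pos, folded K_def \<delta>\<^sub>0_def])
        (assumption | rule that | simp)+
    have x: "x \<in> C" using x_fix by (simp add: almost_fixed_def)

    have x_T: "norm (T i x - x) < \<Omega> (start k)" if i: "i \<in> {1..N}" for i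
    proof (rule \<rho>[OF x \<Omega>_pos _ diam[OF x p] _ i])
      show "cyclic_perm N id" unfolding cyclic_perm_def by (auto simp: cyc_id intro!: exI[of _ 0])
      have "1 / real (f k) \<le> \<rho> d (\<Omega> (start k))"
        using f_ge[of k] f_pos[of k] \<rho>_pos[OF \<Omega>_pos, of d "start k"] by (simp add: field_simps)
      thus "norm (compose_all N T id x - x) < \<rho> d (\<Omega> (start k))"
        using x_fix by (simp add: almost_fixed_def S_def)
    qed

    have lam_le: "lam n \<le> 1 / c" if "0 < c" "n \<ge> chi (nat \<lceil>c\<rceil>)" for n c
      using chi_ceiling_bound[where chi = chi and lam = lam, OF chi that] by simp
    have "lam \<longlonglongrightarrow> 0"
    proof (rule LIMSEQ_I)
      fix r :: real assume r: "0 < r"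
      have "norm (lam n - 0) < r" if "n \<ge> chi (nat \<lceil>2 / r\<rceil>)" for n
        using lam_le[OF _ that] r lam[of n] by simp
      thus "\<exists>no. \<forall>n\<ge>no. norm (lam n - 0) < r" by blast
    qed
    note regular = asymptotic_regularity[OF this sm]
    have u_good: "u m \<in> almost_fixed C S k" if j: "1 \<le> j" "k \<le> j" and m: "start j \<le> m" for j m
    proof -
      \<comment> \<open>Moving by less than \<open>1 / (N * j)\<close> under each \<open>T i\<close> means moving by less than \<open>1 / j\<close> under \<open>S\<close>.\<close>
      define \<eta> where "\<eta> = \<rho> d (1 / (real N * real j))"
      have pos: "0 < 1 / (real N * real j)" using N j by simp
      have "1 / (real N * real j) \<le> 1" using N j by (simp add: field_simps flip: of_nat_mult)
      hence \<eta>: "0 < \<eta>" "\<eta> \<le> 1" using \<rho>_pos[OF pos] \<rho>_le[OF pos] by (auto simp: \<eta>_def intro: order_trans)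
      define s where "s = \<phi>\<^sub>4 (\<eta> / (4 * real d))"
      have m': "\<phi>\<^sub>3 (\<eta> / (2 * real d)) s \<le> m"
        using m by (simp add: start_def chi_hat_def \<eta>_def s_def)
      have pos': "0 < \<eta> / (4 * real d)" "0 < \<eta> / (2 * real d)" using \<eta> d by auto
      have reg: "norm (compose_all N T (\<lambda>i. cyc N (i + m)) (u m) - u m) < \<rho> d (1 / (real N * real j))"
        unfolding \<eta>_def[symmetric]
        using d \<eta> \<phi>4[OF pos'(1)] \<phi>3[OF pos'(2) m'] order_trans[OF \<phi>3_ge[OF pos'(2)] m']
        by (intro regular[of \<eta> s m]) (auto simp: s_def)
      have "cyclic_perm N (\<lambda>i. cyc N (i + m))" by (auto simp: cyclic_perm_def)
      hence disp: "norm (T i (u m) - u m) < 1 / (real N * real j)" if "i \<in> {1..N}" for i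
        using \<rho>[OF u_in pos _ diam[OF u_in p] reg that] by blast
      have "norm (S (u m) - u m) < real N * (1 / (real N * real j))"
        unfolding S_def
        by (rule compose_all_displacement[where C = C]) (fact T_in T_ne u_in disp N)+
      hence "u m \<in> almost_fixed C S j" using N by (simp add: almost_fixed_def u_in)
      thus ?thesis using almost_fixed_antimono[OF k(1) j(2)] by blast
    qed

    \<comment> \<open>The bound is formed with \<open>K\<close>, while \<open>x\<close> is nearly fixed to the precision demanded at
      \<open>start k\<close>, and \<open>start\<close> need not be monotone.  From the smaller of the two indices on, the iterates
      are already \<open>1 / k\<close>-fixed, and the minimum over the arguments in \<open>\<Omega>\<close> covers it.\<close>
    define a where "a = min (start k) (start K)"
    have a_good: "u m \<in> almost_fixed C S k" if "a \<le> m" for m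
      using u_good[of k m] u_good[of K m] k that by (auto simp: a_def min_le_iff_disj)
    define n where "n = \<phi>\<^sub>3 (\<epsilon>\<^sup>2 / (12 * (real d)\<^sup>2)) a"
    define L where "L = max 1 (real (runmax UNIV (gtilde g) n) - real a)"
    have small: "0 < \<epsilon>\<^sup>2 / (12 * (real d)\<^sup>2)" using \<epsilon> d by simp
    have a_n: "a \<le> n" unfolding n_def by (rule \<phi>3_ge[OF small])
    have "n \<le> phi3' \<phi>\<^sub>3 (\<epsilon>\<^sup>2 / (12 * (real d)\<^sup>2)) (start K)"
      unfolding phi3'_def n_def by (intro max.coboundedI2 Max_ge) (auto simp: a_def)
    hence n_Xi: "n \<le> Xi chi \<phi>\<^sub>3 \<phi>\<^sub>4 \<rho> N d \<tau> \<epsilon> g"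
      by (simp add: Xi_def start_def K_def f_def Let_def mult.commute[of "real N"])

    have run_ge: "n \<le> runmax UNIV (gtilde g) n" and g_le: "gtilde g n \<le> runmax UNIV (gtilde g) n"
      using runmax_ge[of n UNIV n "gtilde g"] by (auto simp: gtilde_def)
    have "(\<epsilon> / 2)\<^sup>2 / (3 * (real d)\<^sup>2) = \<epsilon>\<^sup>2 / (12 * (real d)\<^sup>2)" by (simp add: power_divide)
    hence "Omega \<phi>\<^sub>3 d (\<epsilon> / 2) (runmax UNIV (gtilde g)) a = (\<epsilon> / 2)\<^sup>2 / (18 * real d * L)"
      using run_ge by (simp add: Omega_def L_def n_def gtilde_def[of "runmax UNIV (gtilde g)"] max_def)
    hence "\<Omega> (start k) \<le> (\<epsilon> / 2)\<^sup>2 / (18 * real d * L)"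
      using Omega_min_le[of a "start k" \<phi>\<^sub>3 d "\<epsilon> / 2" "runmax UNIV (gtilde g)"]
      by (simp add: \<Omega>_def a_def)
    moreover have L: "1 \<le> L" by (simp add: L_def)
    ultimately have \<Omega>_L: "L * (3 * real d * \<Omega> (start k)) \<le> \<epsilon>\<^sup>2 / 24"
      using d by (simp add: field_simps power2_eq_square)
    have "1 * (3 * real d * \<Omega> (start k)) \<le> L * (3 * real d * \<Omega> (start k))"
      using L \<Omega>_pos[of "start k"] by (intro mult_right_mono) auto
    also have "\<dots> \<le> \<epsilon>\<^sup>2" using \<Omega>_L by (rule order_trans) simp
    also have "\<dots> \<le> real d * real d"
      using power_mono[OF True, of 2] \<epsilon> by (simp add: power2_eq_square)
    finally have "real d * (3 * \<Omega> (start k)) \<le> real d * real d" by simp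
    hence \<Omega>_d: "\<Omega> (start k) \<le> real d" using d \<Omega>_pos[of "start k"] by simp

    \<comment> \<open>The decay condition includes the factor at \<open>a\<close>, the descent estimate starts after it.\<close>
    have "48 * (real d)\<^sup>2 / ((1 - \<tau>) * \<epsilon>\<^sup>2) > 0" using d \<tau> \<epsilon> by simp
    hence "lam a \<le> 1 / (48 * (real d)\<^sup>2 / ((1 - \<tau>) * \<epsilon>\<^sup>2))"
      by (intro lam_le) (auto simp: a_def start_def n_zero_def)
    also have "\<dots> = (1 - \<tau>) * (\<epsilon> / real d)\<^sup>2 / 48" by (simp add: power_divide)
    also have "\<dots> \<le> 1 * 1\<^sup>2 / 48"
      using \<tau> \<epsilon> True by (intro divide_right_mono mult_mono power_mono) auto
    finally have "lam a * (1 - \<tau>) \<le> 1 / 48 * 1" using \<tau> lam by (intro mult_mono) auto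
    hence lam_a: "47 / 48 \<le> 1 - lam a * (1 - \<tau>)" by simp

    have near: "norm (u m - x) \<le> \<epsilon> / 2" if m: "n \<le> m" "m \<le> runmax UNIV (gtilde g) n" for m
    proof -
      define P where "P = (\<Prod>i=Suc a..m. 1 - lam i * (1 - \<tau>))"
      have am: "a \<le> m" using a_n m by simp
      have "47 / 48 * P \<le> (1 - lam a * (1 - \<tau>)) * P"
        using lam_a rate_prod_nonneg by (intro mult_right_mono) (auto simp: P_def)
      also have "\<dots> = (\<Prod>i=a..m. 1 - lam i * (1 - \<tau>))"
        unfolding P_def using am by (simp add: prod.atLeast_Suc_atMost)
      also have "\<dots> \<le> \<epsilon>\<^sup>2 / (12 * (real d)\<^sup>2)" using \<phi>3[OF small, of a m] m by (simp add: n_def)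
      finally have P: "(real d)\<^sup>2 * P \<le> \<epsilon>\<^sup>2 / 12 * (48 / 47)" using d by (simp add: field_simps)
      have "real (m - a) \<le> L" using m am by (simp add: L_def of_nat_diff)
      hence "real (m - a) * (3 * real d * \<Omega> (start k)) \<le> L * (3 * real d * \<Omega> (start k))"
        using \<Omega>_pos[of "start k"] by (intro mult_right_mono) auto
      hence E: "real (m - a) * (3 * real d * \<Omega> (start k)) \<le> \<epsilon>\<^sup>2 / 24" using \<Omega>_L by simp
      have V: "2 * \<delta>\<^sub>0 / (1 - \<tau>) = \<epsilon>\<^sup>2 / 48" using \<tau> by (simp add: \<delta>\<^sub>0_def field_simps)
      have "0 \<le> \<delta>\<^sub>0" using \<tau> by (simp add: \<delta>\<^sub>0_def)
      \<comment> \<open>The available \<open>\<epsilon>\<^sup>2 / 4\<close> covers the three errors: about \<open>\<epsilon>\<^sup>2 / 12\<close> from the initial distance,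
        \<open>\<epsilon>\<^sup>2 / 48\<close> from the variational inequality, \<open>\<epsilon>\<^sup>2 / 24\<close> because \<open>x\<close> is only nearly fixed.\<close>
      hence "(norm (u m - x))\<^sup>2 \<le> (real d)\<^sup>2 * P + 2 * \<delta>\<^sub>0 / (1 - \<tau>)
          + real (m - a) * (3 * real d * \<Omega> (start k))"
        unfolding P_def
        using distance_to_approximate_solution[OF x less_imp_le[OF x_T] \<Omega>_d _ vi[OF a_good] am]
        by simp
      also have "\<dots> \<le> \<epsilon>\<^sup>2 / 4" using P E V zero_le_power2[of \<epsilon>] by linarith
      also have "\<dots> = (\<epsilon> / 2)\<^sup>2" by (simp add: power_divide)
      finally show ?thesis by (rule power2_le_imp_le) (use \<epsilon> in simp)
    qed
    have "norm (u n - u (gtilde g n)) \<le> norm (u n - x) + norm (u (gtilde g n) - x)"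
      using norm_triangle_ineq4[of "u n - x" "u (gtilde g n) - x"] by simp
    also have "\<dots> \<le> \<epsilon> / 2 + \<epsilon> / 2"
      using run_ge g_le by (intro add_mono near) (auto simp: gtilde_def)
    finally show ?thesis using n_Xi by auto
  qed
qed

end
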